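(* Let $d\geq1$, $k\geq1$, $\boldsymbol\mu\in\mathbb{S}^d$ known, $\rho\in[-1,1]$, and $\boldsymbol X_1,\dots,\boldsymbol X_n$ iid $\mathrm{C}_k(\boldsymbol\mu,\rho)$. Define $$\hat\rho_{\mathrm{GM}}=\frac{\tau_{k,d}}{n}\sum_{i=1}^nC_k^{(d-1)/2}(\boldsymbol\mu^\top\boldsymbol X_i).$$ Then (i) $\hat\rho_{\mathrm{GM}}$ is unbiased for $\rho$; (ii) $\hat\rho_{\mathrm{GM}}\to\rho$ almost surely; (iii) $\sqrt n(\hat\rho_{\mathrm{GM}}-\rho)\rightsquigarrow\mathcal N(0,\sigma^2_{\mathrm{GM},k}(\rho))$, where $\sigma^2_{\mathrm{GM},k}(\rho)=d_{k,d}+\rho\,\eta_{k,d}1_{\{k\text{ even}\}}-\rho^2$, with $\eta_{k,1}=0$ and, for $d\geq2$, $$\eta_{k,d}=\frac{(2k+d-1)^2}{(3k+d-1)(d-1)}\frac{k!}{((k/2)!)^3}\frac{\Gamma((d+k-1)/2)^3\Gamma(d+3k/2-1)}{\Gamma(d+k-1)\Gamma((d-1)/2)^2\Gamma((d+3k-1)/2)}.$$ Moreover, for $k=1$, $\sigma^2_{\mathrm{GM},1}(\rho)=d+1-\rho^2$, and for $k=2$, $\sigma^2_{\mathrm{GM},2}(\rho)=\frac{d(d+3)}{2}+\frac{2(d-1)(d+3)}{d+5}\rho-\rho^2$.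
   Context: For $d\geq1$, $\mathbb{S}^d$ is the unit sphere of $\mathbb{R}^{d+1}$ with surface area measure $\sigma_d$ and total area $\omega_d=2\pi^{(d+1)/2}/\Gamma((d+1)/2)$. For $d\geq2$, $C_k^{(d-1)/2}$ is the standard Gegenbauer polynomial of degree $k$ and index $(d-1)/2$ (generating function $(1-2xt+t^2)^{-(d-1)/2}$); for $d=1$, $C_k^0:=T_k$, $T_k(x)=\cos(k\cos^{-1}x)$. $\tilde C_k^{(d-1)/2}=C_k^{(d-1)/2}/C_k^{(d-1)/2}(1)$. $\tau_{k,d}=1+2k/(d-1)$ for $d\geq2$ and $\tau_{k,1}=2-\delta_{k,0}$. $d_{k,d}=(1+2k/(d-1))\Gamma(d-1+k)/(\Gamma(d-1)k!)$ for $d\geq2$, $d_{k,1}=2-\delta_{k,0}$. $\mathrm{C}_k(\boldsymbol\mu,\rho)$ is the distribution on $\mathbb{S}^d$ with density $\omega_d^{-1}\{1+\rho\,\tilde C_k^{(d-1)/2}(\boldsymbol x^\top\boldsymbol\mu)\}$ w.r.t. $\sigma_d$. *)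

theory Defs
  imports "HOL-Probability.Probability"
begin

(* Gegenbauer polynomial C_n^lambda via the standard three-term recurrence
   (equivalent to generating function (1 - 2xt + t^2)^(-lambda)). *)
fun gegenbauer :: "real \<Rightarrow> nat \<Rightarrow> real \<Rightarrow> real" where
  "gegenbauer l 0 x = 1"
| "gegenbauer l (Suc 0) x = 2 * l * x"
| "gegenbauer l (Suc (Suc n)) x =
     (2 * x * (real n + 1 + l) * gegenbauer l (Suc n) x
      - (real n + 2 * l) * gegenbauer l n x) / (real n + 2)"

(* C_k^{(d-1)/2}, with the convention C_k^0 := T_k (Chebyshev) for d = 1 *)
definition gegen :: "nat \<Rightarrow> nat \<Rightarrow> real \<Rightarrow> real" where
  "gegen d k x = (if d = 1 then cos (real k * arccos x)
                  else gegenbauer ((real d - 1) / 2) k x)"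

definition gegen_norm :: "nat \<Rightarrow> nat \<Rightarrow> real \<Rightarrow> real" where
  "gegen_norm d k x = gegen d k x / gegen d k 1"

definition tau :: "nat \<Rightarrow> nat \<Rightarrow> real" where
  "tau k d = (if d = 1 then (if k = 0 then 1 else 2) else 1 + 2 * real k / (real d - 1))"

definition dkd :: "nat \<Rightarrow> nat \<Rightarrow> real" where
  "dkd k d = (if d = 1 then (if k = 0 then 1 else 2)
              else (1 + 2 * real k / (real d - 1)) * Gamma (real d - 1 + real k)
                   / (Gamma (real d - 1) * fact k))"

definition eta :: "nat \<Rightarrow> nat \<Rightarrow> real" where
  "eta k d = (if d = 1 then 0 else
     (2 * real k + real d - 1) ^ 2 / ((3 * real k + real d - 1) * (real d - 1))
     * (fact k / (fact (k div 2)) ^ 3)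
     * (Gamma ((real d + real k - 1) / 2) ^ 3 * Gamma (real d + 3 * real k / 2 - 1))
     / (Gamma (real d + real k - 1) * Gamma ((real d - 1) / 2) ^ 2
        * Gamma ((real d + 3 * real k - 1) / 2)))"

definition sigma2_GM :: "nat \<Rightarrow> nat \<Rightarrow> real \<Rightarrow> real" where
  "sigma2_GM k d \<rho> = dkd k d + \<rho> * eta k d * (if even k then 1 else 0) - \<rho>^2"

(* total surface area of S^d *)
definition omega :: "nat \<Rightarrow> real" where
  "omega d = 2 * pi powr ((real d + 1) / 2) / Gamma ((real d + 1) / 2)"

(* surface area measure on the unit sphere of the euclidean space 'a (dimension d+1),
   given as the cone measure: sigma(A) = DIM('a) * lebesgue{t x : x \<in> A, 0 < t \<le> 1}. *)
definition sphere_measure :: "'a::euclidean_space measure" where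
  "sphere_measure = density
      (distr (restrict_space lborel (ball 0 1 - {0})) borel (\<lambda>x. x /\<^sub>R norm x))
      (\<lambda>_. ennreal (real DIM('a)))"

definition Ck_dist :: "nat \<Rightarrow> 'a::euclidean_space \<Rightarrow> real \<Rightarrow> 'a measure" where
  "Ck_dist k \<mu> \<rho> = (let d = DIM('a) - 1 in
     density sphere_measure
       (\<lambda>x. ennreal ((1 + \<rho> * gegen_norm d k (x \<bullet> \<mu>)) / omega d)))"

definition rho_GM :: "nat \<Rightarrow> 'a::euclidean_space \<Rightarrow> (nat \<Rightarrow> 'b \<Rightarrow> 'a) \<Rightarrow> nat \<Rightarrow> 'b \<Rightarrow> real" where
  "rho_GM k \<mu> X n \<omega> = (let d = DIM('a) - 1 in
     tau k d / real n * (\<Sum>i<n. gegen d k (\<mu> \<bullet> X i \<omega>)))"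

end

theory Submission
  imports Defs
begin

text \<open>
  All quantities in question are means of polynomials in \<open>t = x \<bullet> \<mu>\<close> under the uniform law on the
  sphere. Comparing with Gaussian integrals in polar coordinates gives the moments of \<open>t\<close>, which say that
  the mean satisfies the integration by parts rule \<open>E[(1 - t\<^sup>2) p'(t)] = d E[t p(t)]\<close>. This rule and the
  three-term recurrence determine all means of products of up to three Gegenbauer polynomials
  (Dougall's linearization formula): multiplication by \<open>t\<close> can be moved from one factor to another,
  and the closed form satisfies the resulting recurrence. The case of three equal factors is the constant
  \<open>\<eta>\<close> of the asymptotic variance. The summands of the estimator are bounded, so almost sure convergence
  follows from Hoeffding's inequality and the Borel-Cantelli lemma.
\<close>

section \<open>Gegenbauer polynomials\<close>

text \<open>The obstacle is d = 1, where l = (d-1)/2 = 0: the standard polynomials of index 0 vanish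
  in every positive degree, so the Chebyshev convention has to enter differently. Dividing by the
  value at 1 gives a family that stays meaningful at l = 0, where it is T_n; orthogonality to
  constants is proved once for this family with \<open>l \<ge> 0\<close>. Dougall's formula serves l
  > 0 only, and for d = 1 the double and triple angle formulas take its place. The weight
  exp(-|x|^2) links the cone measure to explicit constants: it factors in polar coordinates, while
  its moments along mu follow from a translation. Two points lie outside the algebra.
  \<open>Ck_dist\<close> cuts negative densities off at zero, so nonnegativity is an issue; it is
  read off from total mass one. And the central limit theorem standardizes by the standard
  deviation, so \<open>sigma2_GM\<close> must be shown to be strictly positive.\<close>

fun normalized_gegenbauer :: "real \<Rightarrow> nat \<Rightarrow> real poly" where
  "normalized_gegenbauer l 0 = 1"
| "normalized_gegenbauer l (Suc 0) = [:0, 1:]"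
| "normalized_gegenbauer l (Suc (Suc n)) = smult (1 / (real n + 1 + 2 * l))
     (smult (2 * (real n + 1 + l)) ([:0, 1:] * normalized_gegenbauer l (Suc n)) - smult (real n + 1) (normalized_gegenbauer l n))"

lemma normalized_gegenbauer_rec:
  assumes "l \<ge> 0"
  shows "smult (real n + 1 + 2 * l) (normalized_gegenbauer l (Suc (Suc n)))
           = smult (2 * (real n + 1 + l)) ([:0, 1:] * normalized_gegenbauer l (Suc n)) - smult (real n + 1) (normalized_gegenbauer l n)"
proof -
  have "real n + 1 + 2 * l \<noteq> 0" using assms by linarith
  then show ?thesis by (simp del: mult_pCons_left)
qed

text \<open>Differentiating the recurrence and eliminating the derivatives by the two previous
  instances leaves an algebraic consequence of the recurrence at n and n + 1. The relation removes
  \<open>pderiv\<close> from \<open>L_ibp\<close> when that rule is applied to a member of the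
  family.\<close>

lemma normalized_gegenbauer_deriv:
  assumes "l \<ge> 0"
  shows "[:1, 0, -1:] * pderiv (normalized_gegenbauer l n)
           = smult (real n + 2 * l) ([:0, 1:] * normalized_gegenbauer l n - normalized_gegenbauer l (Suc n))"
proof -
  have "(1 - x\<^sup>2) * poly (pderiv (normalized_gegenbauer l n)) x
           = (real n + 2 * l) * (x * poly (normalized_gegenbauer l n) x - poly (normalized_gegenbauer l (Suc n)) x)" for x
    using assms
  proof (induction l n rule: normalized_gegenbauer.induct)
    case (1 l)
    then show ?case by simp
  next
    case (2 l)
    have "poly (pderiv (normalized_gegenbauer l (Suc 0))) x = 1" by (simp add: pderiv_pCons)
    moreover have "(1 + 2 * l) * poly (normalized_gegenbauer l (Suc (Suc 0))) x = 2 * (1 + l) * x * x - 1"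
      using arg_cong[OF normalized_gegenbauer_rec[OF 2, of 0], of "\<lambda>p. poly p x"]
      by (simp del: normalized_gegenbauer.simps(3) add: algebra_simps)
    ultimately show ?case by (simp del: normalized_gegenbauer.simps(3) add: algebra_simps power2_eq_square)
  next
    case (3 l n)
    define D0 D1 D2 where "D0 = (1 - x\<^sup>2) * poly (pderiv (normalized_gegenbauer l n)) x"
      and "D1 = (1 - x\<^sup>2) * poly (pderiv (normalized_gegenbauer l (Suc n))) x"
      and "D2 = (1 - x\<^sup>2) * poly (pderiv (normalized_gegenbauer l (Suc (Suc n)))) x"
    define r0 r1 r2 r3 where "r0 = poly (normalized_gegenbauer l n) x"
      and "r1 = poly (normalized_gegenbauer l (Suc n)) x" and "r2 = poly (normalized_gegenbauer l (Suc (Suc n))) x"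
      and "r3 = poly (normalized_gegenbauer l (Suc (Suc (Suc n)))) x"
    note defs = D0_def D1_def D2_def r0_def r1_def r2_def r3_def
    define m where "m = real n"
    define c where "c = m + 1 + 2 * l"
    have c: "c > 0" using 3 by (simp add: c_def m_def)
    have E1: "c * r2 = 2 * (m + 1 + l) * x * r1 - (m + 1) * r0"
      using arg_cong[OF normalized_gegenbauer_rec[OF 3(3), of n], of "\<lambda>p. poly p x"]
      unfolding defs m_def c_def by (simp del: normalized_gegenbauer.simps add: algebra_simps)
    have E2: "(m + 2 + 2 * l) * r3 = 2 * (m + 2 + l) * x * r2 - (m + 2) * r1"
      using arg_cong[OF normalized_gegenbauer_rec[OF 3(3), of "Suc n"], of "\<lambda>p. poly p x"]
      unfolding defs m_def c_def by (simp del: normalized_gegenbauer.simps add: algebra_simps)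
    have E3: "c * D2 = 2 * (m + 1 + l) * ((1 - x\<^sup>2) * r1 + x * D1) - (m + 1) * D0"
      using arg_cong[OF normalized_gegenbauer_rec[OF 3(3), of n], of "\<lambda>p. (1 - x\<^sup>2) * poly (pderiv p) x"]
      unfolding defs m_def c_def
      by (simp del: normalized_gegenbauer.simps mult_pCons_left add: pderiv_smult pderiv_diff pderiv_mult pderiv_pCons algebra_simps)
    have H1: "D1 = c * (x * r1 - r2)" and H0: "D0 = (m + 2 * l) * (x * r0 - r1)"
      using 3 unfolding defs m_def c_def by (simp_all del: normalized_gegenbauer.simps add: algebra_simps)
    have "c * D2 = c * ((m + 2 + 2 * l) * (x * r2 - r3))"
      using E1 E2 E3 H1 H0 c_def by algebra
    then have "D2 = (m + 2 + 2 * l) * (x * r2 - r3)" using c by simp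
    then show ?case unfolding defs m_def by (simp del: normalized_gegenbauer.simps)
  qed
  then show ?thesis
    by (intro poly_eqI_degree[where A = UNIV] poly_eq_poly_eq_iff[THEN iffD1] ext) 
       (simp add: algebra_simps power2_eq_square)
qed

text \<open>The value C_n^l(1): at x = 1 the generating function is (1 - t)^(-2l).\<close>

definition gegenbauer_one :: "real \<Rightarrow> nat \<Rightarrow> real" where
  "gegenbauer_one l n = pochhammer (2 * l) n / fact n"

lemma gegenbauer_one_Suc: "(real n + 1) * gegenbauer_one l (Suc n) = (2 * l + real n) * gegenbauer_one l n"
proof -
  have "real n + 1 \<noteq> 0" by linarith
  moreover have "fact (Suc n) = (real n + 1) * fact n" by (simp add: algebra_simps)
  ultimately show ?thesis unfolding gegenbauer_one_def pochhammer_Suc by (simp del: fact_Suc)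
qed

lemma gegenbauer_one_pos: "l > 0 \<Longrightarrow> gegenbauer_one l n > 0"
  by (simp add: gegenbauer_one_def pochhammer_pos)

definition gegenbauer_poly :: "real \<Rightarrow> nat \<Rightarrow> real poly" where
  "gegenbauer_poly l n = smult (gegenbauer_one l n) (normalized_gegenbauer l n)"

lemma gegenbauer_poly_rec:
  assumes "l > 0"
  shows "smult (real n + 2) (gegenbauer_poly l (Suc (Suc n)))
           = smult (2 * (real n + 1 + l)) ([:0, 1:] * gegenbauer_poly l (Suc n)) - smult (real n + 2 * l) (gegenbauer_poly l n)"
proof -
  have 0: "real n + 1 + 2 * l > 0" using assms by simp
  have 1: "(real n + 2) * gegenbauer_one l (Suc (Suc n)) = (real n + 1 + 2 * l) * gegenbauer_one l (Suc n)"
    using gegenbauer_one_Suc[of "Suc n" l] by (simp add: add_ac)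
  have 2: "(real n + 2 * l) * gegenbauer_one l n = (real n + 1) * gegenbauer_one l (Suc n)"
    using gegenbauer_one_Suc[of n l] by (simp add: add_ac)
  have "smult (real n + 2) (gegenbauer_poly l (Suc (Suc n))) = 
        smult (gegenbauer_one l (Suc n)) (smult (real n + 1 + 2 * l) (normalized_gegenbauer l (Suc (Suc n))))"
    unfolding gegenbauer_poly_def smult_smult 1 by (simp add: mult_ac)
  also have "\<dots> = smult (gegenbauer_one l (Suc n)) (smult (2 * (real n + 1 + l)) ([:0, 1:] * normalized_gegenbauer l (Suc n)))
                 - smult (gegenbauer_one l (Suc n) * (real n + 1)) (normalized_gegenbauer l n)"
    by (subst normalized_gegenbauer_rec) (use assms in \<open>simp_all del: mult_pCons_left add: smult_diff_right\<close>)
  also have "gegenbauer_one l (Suc n) * (real n + 1) = (real n + 2 * l) * gegenbauer_one l n"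
    using 2 by (simp add: mult_ac)
  finally show ?thesis by (simp add: gegenbauer_poly_def mult_ac del: mult_pCons_left)
qed

lemma poly_gegenbauer_poly:
  assumes "l > 0"
  shows "poly (gegenbauer_poly l n) x = gegenbauer l n x"
  using assms
proof (induction l n x rule: gegenbauer.induct)
  case (1 l x)
  then show ?case by (simp add: gegenbauer_poly_def gegenbauer_one_def)
next
  case (2 l x)
  then show ?case by (simp add: gegenbauer_poly_def gegenbauer_one_def)
next
  case (3 l n x)
  have "(real n + 2) * poly (gegenbauer_poly l (Suc (Suc n))) x = 
     2 * (real n + 1 + l) * x * poly (gegenbauer_poly l (Suc n)) x - (real n + 2 * l) * poly (gegenbauer_poly l n) x"
    using arg_cong[OF gegenbauer_poly_rec[OF 3(3), of n], of "\<lambda>p. poly p x"] by (simp add: mult_ac)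
  then show ?case using 3 by (simp add: field_simps)
qed

text \<open>The three-term recurrence solved for x C_n, the form in which a factor x is shifted
  between polynomials. At n = 0 the lower coefficient (2l - 1)/(2l) need not vanish and
  \<open>n - 1\<close> is again 0, so this case is cut out explicitly.\<close>

lemma gegenbauer_poly_X:
  assumes "l > 0"
  shows "[:0, 1:] * gegenbauer_poly l n = smult ((real n + 1) / (2 * (real n + l))) (gegenbauer_poly l (Suc n))
     + (if n = 0 then 0 else smult ((real n + 2 * l - 1) / (2 * (real n + l))) (gegenbauer_poly l (n - 1)))"
proof (cases n)
  case 0
  then show ?thesis using assms by (simp add: gegenbauer_poly_def gegenbauer_one_def)
next
  case (Suc m)
  have "smult (2 * (real n + l)) ([:0, 1:] * gegenbauer_poly l n) =
        smult (real n + 1) (gegenbauer_poly l (Suc n)) + smult (real n + 2 * l - 1) (gegenbauer_poly l (n - 1))"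
    using gegenbauer_poly_rec[OF assms, of m] by (simp add: Suc algebra_simps del: mult_pCons_left)
  then have "smult (inverse (2 * (real n + l))) (smult (2 * (real n + l)) ([:0, 1:] * gegenbauer_poly l n)) =
     smult (inverse (2 * (real n + l))) 
       (smult (real n + 1) (gegenbauer_poly l (Suc n)) + smult (real n + 2 * l - 1) (gegenbauer_poly l (n - 1)))"
    by simp
  moreover have "inverse (2 * (real n + l)) * (2 * (real n + l)) = 1"
    using assms by simp
  ultimately show ?thesis using Suc
    by (simp add: smult_add_right divide_inverse mult_ac del: mult_pCons_left)
qed

lemma gegenbauer_1: "gegenbauer l n 1 = gegenbauer_one l n"
proof (induction l n "1::real" rule: gegenbauer.induct)
  case (3 l n)
  have "(real n + 2) * gegenbauer_one l (Suc (Suc n)) = (real n + 1 + 2 * l) * gegenbauer_one l (Suc n)"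
    using gegenbauer_one_Suc[of "Suc n" l] by (simp add: add_ac)
  moreover have "(real n + 2 * l) * gegenbauer_one l n = (real n + 1) * gegenbauer_one l (Suc n)"
    using gegenbauer_one_Suc[of n l] by (simp add: add_ac)
  ultimately show ?case using 3 by (simp add: field_simps)
qed (simp_all add: gegenbauer_one_def)

text \<open>With theta = arccos x, the sum formula for cos((n+2) theta) + cos(n theta) is the
  recurrence at l = 0 divided by n + 1.\<close>

lemma cos_arccos_eq_normalized_gegenbauer:
  assumes "\<bar>x\<bar> \<le> 1"
  shows "cos (real n * arccos x) = poly (normalized_gegenbauer 0 n) x"
proof -
  \<comment> \<open>The index stays a variable tied by a premise because the induction rule runs
    over both arguments.\<close>
  have "l = 0 \<Longrightarrow> cos (real n * arccos x) = poly (normalized_gegenbauer l n) x" for l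
  proof (induction l n rule: normalized_gegenbauer.induct)
    case (2 l)
    then show ?case using assms by (simp add: cos_arccos abs_le_iff)
  next
    case (3 l n)
    have 1: "cos (real (Suc (Suc n)) * arccos x) + cos (real n * arccos x) 
        = 2 * cos (real (Suc n) * arccos x) * cos (arccos x)"
      by (simp add: cos_plus_cos algebra_simps)
         (simp add: add_divide_distrib)
    have 2: "cos (arccos x) = x" using assms by (simp add: cos_arccos abs_le_iff)
    have "(real n + 1) * poly (normalized_gegenbauer l (Suc (Suc n))) x = (real n + 1) * (2 * x * poly (normalized_gegenbauer l (Suc n)) x - poly (normalized_gegenbauer l n) x)"
      using arg_cong[OF normalized_gegenbauer_rec[of l n], of "\<lambda>p. poly p x"] 3(3)
      by (simp del: normalized_gegenbauer.simps add: algebra_simps)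
    then have "poly (normalized_gegenbauer l (Suc (Suc n))) x = 2 * x * poly (normalized_gegenbauer l (Suc n)) x - poly (normalized_gegenbauer l n) x"
      by (subst (asm) mult_left_cancel) auto
    then show ?case using 1 2 3 by (simp add: algebra_simps del: normalized_gegenbauer.simps)
  qed simp
  then show ?thesis by simp
qed

section \<open>Products of three Gegenbauer polynomials\<close>

text \<open>The coefficient of t^i in (1 - t)^(-l), extended by zero to negative i. Integer indices
  let products of these numbers vanish by themselves when one degree exceeds the sum of the other
  two.\<close>

definition poch_ratio :: "real \<Rightarrow> int \<Rightarrow> real" where
  "poch_ratio l i = (if i < 0 then 0 else pochhammer l (nat i) / fact (nat i))"

text \<open>The extension by zero makes this hold for every integer, including i = 0, where the left
  side has the factor 0 and the right side the value at -1.\<close>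

lemma poch_ratio_rec: "of_int i * poch_ratio l i = (l + of_int i - 1) * poch_ratio l (i - 1)"
proof (cases "i \<ge> 1")
  case True
  define n where "n = nat (i - 1)"
  have i: "i = int (Suc n)" using True by (simp add: n_def)
  have "real n + 1 \<noteq> 0" by linarith
  moreover have "fact (Suc n) = (real n + 1) * fact n" by (simp add: algebra_simps)
  ultimately show ?thesis unfolding i poch_ratio_def
    by (simp del: fact_Suc of_nat_Suc add: pochhammer_Suc nat_add_distrib of_nat_Suc[of n] add.commute)
qed (auto simp: poch_ratio_def)

definition triple_factor :: "real \<Rightarrow> nat \<Rightarrow> real" where
  "triple_factor l s = l / (real s + l) * pochhammer (2 * l) s / pochhammer l s"

lemma triple_factor_Suc:
  assumes "l > 0"
  shows "(real s + 1 + l) * triple_factor l (Suc s) = (real s + 2 * l) * triple_factor l s"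
proof -
  have "pochhammer l s > 0" "real s + l > 0" "real s + 1 + l > 0" using assms by (auto simp: pochhammer_pos)
  then show ?thesis unfolding triple_factor_def pochhammer_Suc by (simp add: divide_simps) (simp add: algebra_simps)
qed

text \<open>Dougall's value for the mean of C_a C_b C_c, with s half the sum of the degrees; odd
  sums give 0 by the symmetry t -> -t. \<open>triple_factor\<close> collects what depends on s
  alone.\<close>

definition triple_mean :: "real \<Rightarrow> nat \<Rightarrow> nat \<Rightarrow> nat \<Rightarrow> real" where
  "triple_mean l a b c = (if odd (a + b + c) then 0 else
     (let s = (a + b + c) div 2 in
        triple_factor l s * poch_ratio l (int s - int a) * poch_ratio l (int s - int b) * poch_ratio l (int s - int c)))"

lemma triple_mean_rotate: "triple_mean l a b c = triple_mean l c a b"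
proof -
  have "c + a + b = a + b + c" by simp
  then show ?thesis unfolding triple_mean_def Let_def by (simp only: mult_ac)
qed

lemma triple_mean_eq: "a + b + c = 2 * s \<Longrightarrow>
   triple_mean l a b c = triple_factor l s * poch_ratio l (int s - int a) * poch_ratio l (int s - int b) * poch_ratio l (int s - int c)"
  by (simp add: triple_mean_def)

text \<open>The content of \<open>triple_mean_rec\<close> for degree sum 2s + 1, in the variables p
  = s+1-a, q = s+1-b, r = s+1-c, so that a = q+r-1 and b = p+r-1. Raising a degree gives half sum s
  + 1, lowering one gives s; once common factors are removed, a polynomial identity in P, Q, R and l
  remains.\<close>

lemma triple_mean_identity_aux:
  fixes p q r :: int and l :: real
  assumes l: "l > 0" and s: "p + q + r = int s + 2" and ab: "q + r \<ge> 1" "p + r \<ge> 1" 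
  defines "P \<equiv> real_of_int p" and "Q \<equiv> real_of_int q" and "R \<equiv> real_of_int r"
  shows "(Q + R) / (Q + R - 1 + l) * (triple_factor l (Suc s) * poch_ratio l (p - 1) * poch_ratio l q * poch_ratio l r)
      + (Q + R - 2 + 2 * l) / (Q + R - 1 + l) * (triple_factor l s * poch_ratio l p * poch_ratio l (q - 1) * poch_ratio l (r - 1))
      = (P + R) / (P + R - 1 + l) * (triple_factor l (Suc s) * poch_ratio l p * poch_ratio l (q - 1) * poch_ratio l r)
      + (P + R - 2 + 2 * l) / (P + R - 1 + l) * (triple_factor l s * poch_ratio l (p - 1) * poch_ratio l q * poch_ratio l (r - 1))"
proof -
  have rs: "real s = P + Q + R - 2" using arg_cong[OF s, of real_of_int] by (simp add: P_def Q_def R_def)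
  have "real s + 1 + l = P + Q + R - 1 + l" by (simp add: rs)
  then have H: "(P + Q + R - 1 + l) * triple_factor l (Suc s) = (P + Q + R - 2 + 2 * l) * triple_factor l s"
    using triple_factor_Suc[OF l, of s] by (simp only: rs)
  \<comment> \<open>Both values of \<open>triple_factor\<close> are polynomial multiples of
    \<open>h\<close>, by \<open>triple_factor_Suc\<close>.\<close>
  define h where "h = triple_factor l s / (P + Q + R - 1 + l)"
  have pos: "P + Q + R - 1 + l > 0" using rs l by linarith
  have h: "triple_factor l s = (P + Q + R - 1 + l) * h" "triple_factor l (Suc s) = (P + Q + R - 2 + 2 * l) * h"
    using H pos by (simp_all add: h_def field_simps)
  have QR: "Q + R - 1 + l > 0" using ab l unfolding Q_def R_def by linarith
  have PR: "P + R - 1 + l > 0" using ab l unfolding P_def R_def by linarith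
  consider "p < 0 \<or> q < 0 \<or> r < 0" | "p \<ge> 0" "q \<ge> 0" "r \<ge> 0" by linarith
  then show ?thesis
  proof cases
    case 1
    then show ?thesis by (auto simp: poch_ratio_def)
  next
    case 2
    have ap: "P * poch_ratio l p = (l + P - 1) * poch_ratio l (p - 1)" and aq: "Q * poch_ratio l q = (l + Q - 1) * poch_ratio l (q - 1)"
      and ar: "R * poch_ratio l r = (l + R - 1) * poch_ratio l (r - 1)"
      using poch_ratio_rec[of p l] poch_ratio_rec[of q l] poch_ratio_rec[of r l] by (auto simp: P_def Q_def R_def)
    \<comment> \<open>By \<open>poch_ratio_rec\<close> neighbouring values are proportional to (u, l
      + u - 1), which makes the claim polynomial without dividing by l + u - 1. The case u = 0 is
      separate: then x = 0 while y can be 1, and for l = 1 no such t exists.\<close>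
    have par: "(\<exists>t. x = u * t \<and> y = (l + u - 1) * t) \<or> (u = 0 \<and> x = 0)"
      if "u * y = (l + u - 1) * x" "u = 0 \<longrightarrow> x = 0" for u x y :: real
    proof (cases "u = 0")
      case False
      then show ?thesis using that by (intro disjI1 exI[of _ "x / u"]) (simp add: field_simps)
    qed (use that in auto)
    have zp: "P = 0 \<longrightarrow> poch_ratio l (p - 1) = 0" and zq: "Q = 0 \<longrightarrow> poch_ratio l (q - 1) = 0"
      and zr: "R = 0 \<longrightarrow> poch_ratio l (r - 1) = 0" by (simp_all add: poch_ratio_def P_def Q_def R_def)
    define x x' y y' z z' where "x = poch_ratio l (p - 1)" and "x' = poch_ratio l p" and "y = poch_ratio l (q - 1)"
      and "y' = poch_ratio l q" and "z = poch_ratio l (r - 1)" and "z' = poch_ratio l r"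
    have ne: "\<not> (P = 0 \<and> R = 0)" "\<not> (Q = 0 \<and> R = 0)" using ab by (auto simp: P_def Q_def R_def)
    define U where "U = P + Q + R - 2 + 2 * l"
    define V where "V = P + Q + R - 1 + l"
    have core: "((Q + R) * U * P * (l + Q - 1) * (l + R - 1) 
          + (Q + R - 2 + 2 * l) * V * (l + P - 1) * Q * R) * (P + R - 1 + l)
        = ((P + R) * U * (l + P - 1) * Q * (l + R - 1)
          + (P + R - 2 + 2 * l) * V * P * (l + Q - 1) * R) * (Q + R - 1 + l)"
      unfolding U_def V_def by algebra
    have "((Q + R) * (U * h * x * y' * z') + (Q + R - 2 + 2 * l) * (V * h * x' * y * z)) * (P + R - 1 + l)
       = ((P + R) * (U * h * x' * y * z') + (P + R - 2 + 2 * l) * (V * h * x * y' * z)) * (Q + R - 1 + l)"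
    proof -
      consider (P) "P = 0" "x = 0" | (Q) "Q = 0" "y = 0" | (R) "R = 0" "z = 0" 
        | (T) t u v where "x = P * t" "x' = (l + P - 1) * t" "y = Q * u" "y' = (l + Q - 1) * u"
            "z = R * v" "z' = (l + R - 1) * v"
        using par[OF ap zp] par[OF aq zq] par[OF ar zr] 
        unfolding x_def y_def z_def x'_def y'_def z'_def by blast
      then show ?thesis
      proof cases
        case P
        then obtain v where v: "z = R * v" "z' = (l + R - 1) * v" 
          using par[OF ar zr] ne unfolding z_def z'_def by blast
        show ?thesis unfolding P v U_def V_def by (simp add: algebra_simps)
      next
        case Q
        then obtain v where v: "z = R * v" "z' = (l + R - 1) * v" 
          using par[OF ar zr] ne unfolding z_def z'_def by blast
        show ?thesis unfolding Q v U_def V_def by (simp add: algebra_simps)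
      next
        case R
        then obtain t u where v: "x = P * t" "x' = (l + P - 1) * t" "y = Q * u" "y' = (l + Q - 1) * u"
          using par[OF ap zp] par[OF aq zq] ne unfolding x_def x'_def y_def y'_def by blast
        show ?thesis unfolding R v by (simp add: algebra_simps)
      next
        case T
        have factor: "(A * (U * h * (p * t) * (q' * u) * (r' * v)) + B * (V * h * (p' * t) * (q * u) * (r * v))) * C
          = ((A * U * p * q' * r' + B * V * p' * q * r) * C) * (h * t * u * v)"
          and factor2: "(A * (U * h * (p' * t) * (q * u) * (r' * v)) + B * (V * h * (p * t) * (q' * u) * (r * v))) * C
          = ((A * U * p' * q * r' + B * V * p * q' * r) * C) * (h * t * u * v)"
          for A B C p p' q q' r r' :: real by algebra+
        have "((Q + R) * (U * h * x * y' * z') + (Q + R - 2 + 2 * l) * (V * h * x' * y * z)) * (P + R - 1 + l)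
          = (((Q + R) * U * P * (l + Q - 1) * (l + R - 1) 
          + (Q + R - 2 + 2 * l) * V * (l + P - 1) * Q * R) * (P + R - 1 + l)) * (h * t * u * v)"
          unfolding T by (rule factor)
        also note core
        also have "((P + R) * U * (l + P - 1) * Q * (l + R - 1)
          + (P + R - 2 + 2 * l) * V * P * (l + Q - 1) * R) * (Q + R - 1 + l) * (h * t * u * v)
          = ((P + R) * (U * h * x' * y * z') + (P + R - 2 + 2 * l) * (V * h * x * y' * z)) * (Q + R - 1 + l)"
          unfolding T by (rule factor2[symmetric])
        finally show ?thesis .
      qed
    qed
    then show ?thesis using QR PR unfolding h U_def[symmetric] V_def[symmetric]
        x_def[symmetric] y_def[symmetric] z_def[symmetric] x'_def[symmetric] y'_def[symmetric] z'_def[symmetric]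
      by (simp only: times_divide_eq_left add_divide_distrib[symmetric]) (subst frac_eq_eq, auto simp: mult_ac)
  qed
qed

text \<open>Both sides are what \<open>gegenbauer_poly_X\<close> makes of the mean of x C_a C_b C_c,
  with x attached to C_a or to C_b; the closed form has to respect this to be the mean.\<close>

lemma triple_mean_rec:
  assumes l: "l > 0"
  shows "(real a + 1) / (2 * (real a + l)) * triple_mean l (Suc a) b c
      + (if a = 0 then 0 else (real a + 2 * l - 1) / (2 * (real a + l)) * triple_mean l (a - 1) b c)
      = (real b + 1) / (2 * (real b + l)) * triple_mean l a (Suc b) c
      + (if b = 0 then 0 else (real b + 2 * l - 1) / (2 * (real b + l)) * triple_mean l a (b - 1) c)"
proof (cases "odd (a + b + c)")
  case False
  \<comment> \<open>Every neighbouring degree sum is odd here, so all terms vanish.\<close>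
  then show ?thesis by (auto simp: triple_mean_def)
next
  case True
  then obtain s where s: "a + b + c = 2 * s + 1" by (elim oddE)
  define p q r where "p = int s + 1 - int a" and "q = int s + 1 - int b" and "r = int s + 1 - int c"
  have sum: "p + q + r = int s + 2" using s by (simp add: p_def q_def r_def)
  have a: "real a = real_of_int q + real_of_int r - 1" 
    using s by (simp add: q_def r_def)
  have b: "real b = real_of_int p + real_of_int r - 1" 
    using s by (simp add: p_def r_def)
  have 1: "triple_mean l (Suc a) b c = triple_factor l (Suc s) * poch_ratio l (p - 1) * poch_ratio l q * poch_ratio l r"
    by (subst triple_mean_eq[of _ _ _ "Suc s"]) (use s in \<open>auto simp: p_def q_def r_def add_ac\<close>)
  have 2: "triple_mean l a (Suc b) c = triple_factor l (Suc s) * poch_ratio l p * poch_ratio l (q - 1) * poch_ratio l r"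
    by (subst triple_mean_eq[of _ _ _ "Suc s"]) (use s in \<open>auto simp: p_def q_def r_def add_ac\<close>)
  have 3: "(if a = 0 then 0 else triple_mean l (a - 1) b c) = triple_factor l s * poch_ratio l p * poch_ratio l (q - 1) * poch_ratio l (r - 1)"
  proof (cases "a = 0")
    case True
    \<comment> \<open>Here q + r = a + 1 = 1, so one of q - 1, r - 1 is negative and the absent term
      agrees with the formula.\<close>
    then have "q - 1 < 0 \<or> r - 1 < 0" using s by (auto simp: q_def r_def)
    then show ?thesis using True by (auto simp: poch_ratio_def)
  next
    case False
    then show ?thesis by (simp, subst triple_mean_eq[of _ _ _ s]) (use s in \<open>auto simp: p_def q_def r_def of_nat_diff algebra_simps\<close>)
  qed
  have 4: "(if b = 0 then 0 else triple_mean l a (b - 1) c) = triple_factor l s * poch_ratio l (p - 1) * poch_ratio l q * poch_ratio l (r - 1)"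
  proof (cases "b = 0")
    case True
    then have "p - 1 < 0 \<or> r - 1 < 0" using s by (auto simp: p_def r_def)
    then show ?thesis using True by (auto simp: poch_ratio_def)
  next
    case False
    then show ?thesis by (simp, subst triple_mean_eq[of _ _ _ s]) (use s in \<open>auto simp: p_def q_def r_def of_nat_diff algebra_simps\<close>)
  qed
  have "q + r \<ge> 1" "p + r \<ge> 1" using s by (auto simp: p_def q_def r_def)
  note * = triple_mean_identity_aux[OF l sum this, folded 1 2 3 4]
  have e: "(if n = 0 then 0 else x / (2 * y) * t) = 1/2 * (x / y * (if n = 0 then 0 else t))" for n :: nat and x y t :: real
    by simp
  have e2: "x / (2 * y) * t = 1 / 2 * (x / y * t)" for x y t :: real by simp
  show ?thesis unfolding e e2[of "real _ + 1"] distrib_left[symmetric]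
    using * unfolding a b by (simp add: algebra_simps)
qed

text \<open>Abstracts the mean of p(t) on the sphere, with 2l + 1 = d. On monomials
  \<open>L_ibp\<close> is a two-step recurrence for the moments of \<open>L\<close>, so together
  with \<open>L_1\<close> and linearity it fixes \<open>L\<close> without reference to an
  integral.\<close>

locale gegen_functional =
  fixes l :: real and L :: "real poly \<Rightarrow> real"
  assumes l_nonneg: "l \<ge> 0"
    and L_add: "L (p + q) = L p + L q"
    and L_smult: "L (smult c p) = c * L p"
    and L_1: "L 1 = 1"
    and L_ibp: "L ([:1, 0, -1:] * pderiv p) = (2 * l + 1) * L ([:0, 1:] * p)"
begin

lemma L_0: "L 0 = 0" using L_smult[of 0 0] by simp

lemma L_diff: "L (p - q) = L p - L q"
  using L_add[of p "smult (-1) q"] L_smult[of "-1" q] by simp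

text \<open>Two consecutive indices are carried along since the recurrence reaches back two steps.
  Applying \<open>L\<close> to the recurrence and, through \<open>L_ibp\<close>, to
  \<open>normalized_gegenbauer_deriv\<close> gives two linear equations for the means u and v of
  R_(n+2) and x R_(n+1), where R_n is \<open>normalized_gegenbauer l n\<close>; they force u =
  0.\<close>

lemma L_normalized_gegenbauer_Suc: "L (normalized_gegenbauer l (Suc n)) = 0 \<and> (n \<ge> 1 \<longrightarrow> L (normalized_gegenbauer l n) = 0)"
  proof (induction n)
    case 0
    have "(2 * l + 1) * L (normalized_gegenbauer l (Suc 0)) = 0" using L_ibp[of 1] by (simp add: L_0)
    then show ?case using l_nonneg by (auto simp: add_nonneg_eq_0_iff)
  next
    case (Suc n)
    define m where "m = real n"
    have m: "m \<ge> 0" by (simp add: m_def)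
    have 1: "(m + 1 + 2 * l) * L (normalized_gegenbauer l (Suc (Suc n))) = 2 * (m + 1 + l) * L ([:0, 1:] * normalized_gegenbauer l (Suc n)) - (m + 1) * L (normalized_gegenbauer l n)"
      using arg_cong[OF normalized_gegenbauer_rec[OF l_nonneg, of n], of L] unfolding L_diff L_smult m_def by simp
    have 2: "(m + 1 + 2 * l) * (L ([:0, 1:] * normalized_gegenbauer l (Suc n)) - L (normalized_gegenbauer l (Suc (Suc n)))) = (2 * l + 1) * L ([:0, 1:] * normalized_gegenbauer l (Suc n))"
      using L_ibp[of "normalized_gegenbauer l (Suc n)"] normalized_gegenbauer_deriv[OF l_nonneg, of "Suc n"]
      by (simp only: L_smult L_diff) (simp add: m_def add_ac)
    \<comment> \<open>The factor m absorbs the exceptional index n = 0, where the mean is 1 rather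
      than 0.\<close>
    have 3: "m * L (normalized_gegenbauer l n) = 0" using Suc by (auto simp: m_def)
    define u v where "u = L (normalized_gegenbauer l (Suc (Suc n)))" and "v = L ([:0, 1:] * normalized_gegenbauer l (Suc n))"
    have k2: "m * v = (m + 1 + 2 * l) * u" using 2 by (simp add: u_def v_def algebra_simps)
    have "(m + 1 + 2 * l) * (m * u) = 2 * (m + 1 + l) * (m * v) - (m + 1) * (m * L (normalized_gegenbauer l n))"
      using arg_cong[OF 1[folded u_def v_def], of "\<lambda>x. m * x"] by (simp only: algebra_simps)
    then have "(m + 1 + 2 * l) * (m * u) = 2 * (m + 1 + l) * ((m + 1 + 2 * l) * u)"
      using 3 k2 by simp
    then have "(m + 1 + 2 * l) * ((m + 2 + 2 * l) * u) = 0" by (simp add: algebra_simps)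
    moreover have "m + 1 + 2 * l > 0" "m + 2 + 2 * l > 0" using m l_nonneg by linarith+
    ultimately have "u = 0" by simp
    then show ?case using Suc by (simp add: u_def)
  qed

lemma L_normalized_gegenbauer: "L (normalized_gegenbauer l n) = (if n = 0 then 1 else 0)"
  using L_normalized_gegenbauer_Suc[of "n - 1"] by (cases n) (auto simp: L_1)

lemma L_gegenbauer_poly: "L (gegenbauer_poly l n) = (if n = 0 then 1 else 0)"
  by (simp add: gegenbauer_poly_def L_smult L_normalized_gegenbauer gegenbauer_one_def)

lemma gegenbauer_poly_0: "gegenbauer_poly l 0 = 1" by (simp add: gegenbauer_poly_def gegenbauer_one_def)

text \<open>Induction on a for all b at once: moving x from C_n to C_b expresses degree n + 1 in the
  first factor by degrees at most n there, at the price of changing b. The third factor is a fixed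
  parameter.\<close>

lemma L_triple_step:
  assumes l: "l > 0" and base: "\<And>b. L (gegenbauer_poly l b * gegenbauer_poly l c) = triple_mean l 0 b c"
  shows "L (gegenbauer_poly l a * gegenbauer_poly l b * gegenbauer_poly l c) = triple_mean l a b c"
proof (induction a arbitrary: b rule: less_induct)
  case (less a)
  show ?case
  proof (cases a)
    case 0
    then show ?thesis using base by (simp add: gegenbauer_poly_0)
  next
    case (Suc n)
    have IH: "L (gegenbauer_poly l n * gegenbauer_poly l b * gegenbauer_poly l c) = triple_mean l n b c" for b using less Suc by simp
    have IH': "n \<noteq> 0 \<Longrightarrow> L (gegenbauer_poly l (n - 1) * gegenbauer_poly l b * gegenbauer_poly l c) = triple_mean l (n - 1) b c" for b using less Suc by simp
    have "L (([:0, 1:] * gegenbauer_poly l n) * gegenbauer_poly l b * gegenbauer_poly l c) = L (gegenbauer_poly l n * ([:0, 1:] * gegenbauer_poly l b) * gegenbauer_poly l c)"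
      by (simp add: mult_ac)
    then have "(real n + 1) / (2 * (real n + l)) * L (gegenbauer_poly l (Suc n) * gegenbauer_poly l b * gegenbauer_poly l c)
      + (if n = 0 then 0 else (real n + 2 * l - 1) / (2 * (real n + l)) * triple_mean l (n - 1) b c)
      = (real b + 1) / (2 * (real b + l)) * triple_mean l n (Suc b) c
      + (if b = 0 then 0 else (real b + 2 * l - 1) / (2 * (real b + l)) * triple_mean l n (b - 1) c)"
      unfolding gegenbauer_poly_X[OF l]
      by (cases "n = 0"; cases "b = 0")
        (use IH IH' in \<open>simp_all only: if_True if_False distrib_left distrib_right L_add L_smult mult_smult_left
          mult_smult_right not_False_eq_True add_0_right refl mult_zero_left mult_zero_right L_0\<close>)
    then have "(real n + 1) / (2 * (real n + l)) * L (gegenbauer_poly l (Suc n) * gegenbauer_poly l b * gegenbauer_poly l c)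
       = (real n + 1) / (2 * (real n + l)) * triple_mean l (Suc n) b c"
      using triple_mean_rec[OF l, of n b c] by linarith
    moreover have "(real n + 1) / (2 * (real n + l)) \<noteq> 0" using l by (simp add: add_nonneg_eq_0_iff)
    ultimately show ?thesis unfolding Suc by (rule mult_left_cancel[THEN iffD1, rotated])
  qed
qed

lemma triple_mean_00: "l > 0 \<Longrightarrow> triple_mean l 0 b 0 = (if b = 0 then 1 else 0)"
  by (auto simp: triple_mean_def poch_ratio_def triple_factor_def Let_def elim!: evenE)

text \<open>The step lemma is used twice. With c = 0 its base case is the mean of a single
  polynomial; the resulting formula for two factors, rotated by \<open>triple_mean_rotate\<close>,
  is the base case for arbitrary c.\<close>

lemma L_triple:
  assumes l: "l > 0" 
  shows "L (gegenbauer_poly l a * gegenbauer_poly l b * gegenbauer_poly l c) = triple_mean l a b c"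
proof -
  have "L (gegenbauer_poly l b * gegenbauer_poly l 0) = triple_mean l 0 b 0" for b 
    using l by (simp add: gegenbauer_poly_0 L_gegenbauer_poly triple_mean_00)
  then have 1: "L (gegenbauer_poly l a * gegenbauer_poly l b * gegenbauer_poly l 0) = triple_mean l a b 0" for a b
    by (rule L_triple_step[OF l])
  have "L (gegenbauer_poly l b * gegenbauer_poly l c) = triple_mean l 0 b c" for b
    using 1[of b c] triple_mean_rotate[of l b c 0] by (simp add: gegenbauer_poly_0)
  then show ?thesis by (rule L_triple_step[OF l])
qed

end

section \<open>Polar coordinates and Gaussian moments\<close>

lemma nn_integral_lborel_scale:
  fixes f :: "'a::euclidean_space \<Rightarrow> ennreal"
  assumes [measurable]: "f \<in> borel_measurable borel" and c: "c \<noteq> 0"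
  shows "(\<integral>\<^sup>+x. f x \<partial>lborel) = ennreal (\<bar>c\<bar> ^ DIM('a)) * (\<integral>\<^sup>+x. f (t + c *\<^sub>R x) \<partial>lborel)"
  by (subst lborel_affine[OF c, of t])
     (simp add: nn_integral_density nn_integral_distr nn_integral_cmult ennreal_power)

lemma nn_integral_pball_scale:
  fixes h :: "'a::euclidean_space \<Rightarrow> ennreal"
  assumes [measurable]: "h \<in> borel_measurable borel"
    and h: "\<And>c x. c > 0 \<Longrightarrow> h (c *\<^sub>R x) = h x" and s: "s > 0"
  shows "(\<integral>\<^sup>+x. h x * indicator (ball 0 s) x \<partial>lborel)
           = ennreal (s ^ DIM('a)) * (\<integral>\<^sup>+x. h x * indicator (ball 0 1) x \<partial>lborel)"
proof -
  have [measurable]: "ball (0::'a) s \<in> sets borel" by simp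
  have "indicator (ball 0 s) (s *\<^sub>R x) = (indicator (ball 0 1) x :: ennreal)" for x :: 'a
    using s by (auto simp: indicator_def)
  then show ?thesis
    using s by (subst nn_integral_lborel_scale[of _ s 0]) (simp_all add: h, measurable)
qed

lemma nn_integral_power_Icc:
  fixes s :: real
  assumes "s \<ge> 0" "n > 0"
  shows "(\<integral>\<^sup>+r. ennreal (real n * r ^ (n - 1)) * indicator {0..s} r \<partial>lborel) = ennreal (s ^ n)"
proof -
  have "(\<integral>\<^sup>+r. ennreal (real n * r ^ (n - 1)) * indicator {0..s} r \<partial>lborel) = ennreal (s ^ n - 0 ^ n)"
    using assms by (intro nn_integral_FTC_Icc) (auto intro!: derivative_eq_intros)
  then show ?thesis using assms by simp
qed

text \<open>The core of polar coordinates: for h homogeneous of degree 0 the h-mass of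
  \<open>ball 0 s\<close> is s^DIM times that of the unit ball, and these masses determine the law
  of the norm on half-lines.\<close>

lemma distr_norm_homogeneous:
  fixes h :: "'a::euclidean_space \<Rightarrow> ennreal"
  assumes [measurable]: "h \<in> borel_measurable borel"
    and h: "\<And>c x. c > 0 \<Longrightarrow> h (c *\<^sub>R x) = h x"
  defines "S \<equiv> \<integral>\<^sup>+x. h x * indicator (ball 0 1) x \<partial>lborel"
  assumes S: "S < \<infinity>"
  shows "distr (density lborel h) borel norm 
    = density lborel (\<lambda>r. S * (ennreal (real DIM('a) * r ^ (DIM('a) - 1)) * indicator {0..} r))"
    (is "?M = ?N")
proof (rule measure_eqI_generator_eq[where E = "range lessThan" and \<Omega> = UNIV and A = "\<lambda>i. {..<real i}"])
  show "Int_stable (range lessThan :: real set set)"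
  proof -
    have "{..<a} \<inter> {..<b} = {..<min a b}" for a b :: real by auto
    then show ?thesis by (auto simp: Int_stable_def)
  qed
  have *: "emeasure ?M {..<s} = (if s \<le> 0 then 0 else S * ennreal (s ^ DIM('a)))" for s
  proof -
    have "norm -` {..<s} = ball (0::'a) s" by auto
    then have "emeasure ?M {..<s} = (\<integral>\<^sup>+x. h x * indicator (ball 0 s) x \<partial>lborel)"
      by (simp add: emeasure_distr emeasure_density)
    then show ?thesis using nn_integral_pball_scale[of h s] h
      by (cases "s \<le> 0") (auto simp: S_def mult.commute ball_empty)
  qed
  have **: "emeasure ?N {..<s} = (if s \<le> 0 then 0 else S * ennreal (s ^ DIM('a)))" for s
  proof (cases "s \<le> 0")
    case True
    have "emeasure ?N {..<s} = (\<integral>\<^sup>+r. S * (ennreal (real DIM('a) * r ^ (DIM('a) - 1)) * indicator {0..} r)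
        * indicator {..<s} r \<partial>lborel)"
      by (rule emeasure_density) auto
    also have "\<dots> = (\<integral>\<^sup>+r. 0 \<partial>(lborel :: real measure))"
      using True by (intro nn_integral_cong) (auto simp: indicator_def)
    finally show ?thesis using True by simp
  next
    case False
    have "emeasure ?N {..<s} = (\<integral>\<^sup>+r. S * (ennreal (real DIM('a) * r ^ (DIM('a) - 1)) * indicator {0..s} r) \<partial>lborel)"
      by (auto simp: emeasure_density indicator_def intro!: nn_integral_cong_AE eventually_mono[OF AE_lborel_singleton[of s]])
    also have "\<dots> = S * ennreal (s ^ DIM('a))"
      using False nn_integral_power_Icc[of s "DIM('a)"] by (subst nn_integral_cmult) auto
    finally show ?thesis using False by simp
  qed
  show "emeasure ?M X = emeasure ?N X" if "X \<in> range lessThan" for X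
    using that * ** by auto
  show "sets ?M = sigma_sets UNIV (range lessThan)" "sets ?N = sigma_sets UNIV (range lessThan)"
    unfolding sets_distr sets_density sets_lborel by (subst borel_Iio, simp)+
  show "(\<Union>i. {..<real i}) = UNIV" by (auto intro: reals_Archimedean2)
  show "emeasure ?M {..<real i} \<noteq> \<infinity>" for i
    using S by (auto simp: * ennreal_mult_eq_top_iff)
qed auto

lemma nn_integral_polar:
  fixes h :: "'a::euclidean_space \<Rightarrow> ennreal"
  assumes [measurable]: "h \<in> borel_measurable borel" "g \<in> borel_measurable borel"
    and h: "\<And>c x. c > 0 \<Longrightarrow> h (c *\<^sub>R x) = h x"
    and S: "(\<integral>\<^sup>+x. h x * indicator (ball 0 1) x \<partial>lborel) < \<infinity>"
  shows "(\<integral>\<^sup>+x. h x * g (norm x) \<partial>lborel) = (\<integral>\<^sup>+x. h x * indicator (ball 0 1) x \<partial>lborel)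
     * (\<integral>\<^sup>+r. ennreal (real DIM('a) * r ^ (DIM('a) - 1)) * indicator {0..} r * g r \<partial>lborel)"
proof -
  have "(\<integral>\<^sup>+x. h x * g (norm x) \<partial>lborel) = (\<integral>\<^sup>+r. g r \<partial>distr (density lborel h) borel norm)"
    by (simp add: nn_integral_distr nn_integral_density)
  also have "\<dots> = (\<integral>\<^sup>+r. (\<integral>\<^sup>+x. h x * indicator (ball 0 1) x \<partial>lborel) * 
      (ennreal (real DIM('a) * r ^ (DIM('a) - 1)) * indicator {0..} r * g r) \<partial>lborel)"
    by (subst distr_norm_homogeneous[OF _ h S]) (simp_all add: nn_integral_density mult_ac)
  also have "\<dots> = (\<integral>\<^sup>+x. h x * indicator (ball 0 1) x \<partial>lborel)
     * (\<integral>\<^sup>+r. ennreal (real DIM('a) * r ^ (DIM('a) - 1)) * indicator {0..} r * g r \<partial>lborel)"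
    by (subst nn_integral_cmult) simp_all
  finally show ?thesis .
qed

text \<open>Equals Gamma((k+1)/2)/2, so that \<open>half_gauss_rec\<close> is the functional
  equation of Gamma. The closed forms differ for even and odd k, hence the parity splits
  below.\<close>

definition half_gauss :: "nat \<Rightarrow> real" where
  "half_gauss k = (LINT r:{0..}|lborel. exp (- r\<^sup>2) * r ^ k)"

lemma half_gauss_even: "half_gauss (2 * k) = sqrt pi / 2 * (fact (2 * k) / (2 ^ (2 * k) * fact k))"
  using gaussian_moment_even_pos[of k]
  by (simp add: half_gauss_def has_bochner_integral_iff set_lebesgue_integral_def)

lemma half_gauss_odd: "half_gauss (2 * k + 1) = fact k / 2"
  using gaussian_moment_odd_pos[of k]
  by (simp add: half_gauss_def has_bochner_integral_iff set_lebesgue_integral_def)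

lemma half_gauss_pos: "half_gauss k > 0"
proof (cases "even k")
  case True
  then obtain j where "k = 2 * j" by (elim evenE)
  then show ?thesis by (simp add: half_gauss_even)
next
  case False
  then obtain j where "k = 2 * j + 1" by (elim oddE)
  then show ?thesis by (simp only: half_gauss_odd) simp
qed

lemma half_gauss_rec: "2 * half_gauss (k + 2) = real (k + 1) * half_gauss k"
proof (cases "even k")
  case True
  then obtain j where k: "k = 2 * j" by (elim evenE)
  have "fact (2 * (j + 1)) = (2 * real j + 2) * (2 * real j + 1) * fact (2 * j)"
    and "fact (j + 1) = (real j + 1) * fact j" by (simp_all add: algebra_simps)
  moreover have "real j + 1 \<noteq> 0" by linarith
  ultimately have eq: "fact (2 * (j + 1)) / (2 ^ (2 * (j + 1)) * fact (j + 1)) 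
      = (2 * real j + 1) / 2 * (fact (2 * j) / (2 ^ (2 * j) * fact j))"
    by (simp del: fact_Suc add: divide_simps power_add)
  have "2 * half_gauss (2 * (j + 1)) = real (2 * j + 1) * half_gauss (2 * j)"
    unfolding half_gauss_even eq by (simp add: mult_ac add_ac)
  moreover have "k + 2 = 2 * (j + 1)" using k by simp
  ultimately show ?thesis unfolding k by simp
next
  case False
  then obtain j where k: "k = 2 * j + 1" by (elim oddE)
  have "2 * half_gauss (2 * (j + 1) + 1) = real (2 * j + 1 + 1) * half_gauss (2 * j + 1)"
    unfolding half_gauss_odd by simp
  moreover have "k + 2 = 2 * (j + 1) + 1" using k by simp
  ultimately show ?thesis unfolding k by (simp only:)
qed

lemma nn_integral_half_gauss:
  "(\<integral>\<^sup>+r. indicator {0..} r * ennreal (exp (- r\<^sup>2) * r ^ k) \<partial>lborel) = ennreal (half_gauss k)"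
proof -
  have "integrable lborel (\<lambda>x::real. indicator {0..} x *\<^sub>R (exp (-x\<^sup>2)*x^k))"
  proof (cases "even k")
    case True
    then obtain j where "k = 2 * j" by (elim evenE)
    then show ?thesis using gaussian_moment_even_pos[of j] by (auto simp: has_bochner_integral_iff)
  next
    case False
    then obtain j where "k = 2 * j + 1" by (elim oddE)
    then show ?thesis using gaussian_moment_odd_pos[of j] by (auto simp: has_bochner_integral_iff)
  qed
  then have "(\<integral>\<^sup>+r. ennreal (indicator {0..} r *\<^sub>R (exp (- r\<^sup>2) * r ^ k)) \<partial>lborel) = ennreal (half_gauss k)"
    unfolding half_gauss_def set_lebesgue_integral_def
    by (intro nn_integral_eq_integral) (auto simp: indicator_def)
  also have "(\<integral>\<^sup>+r. ennreal (indicator {0..} r *\<^sub>R (exp (- r\<^sup>2) * r ^ k)) \<partial>lborel) 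
    = (\<integral>\<^sup>+r. indicator {0..} r * ennreal (exp (- r\<^sup>2) * r ^ k) \<partial>lborel)"
    by (intro nn_integral_cong) (auto simp: indicator_def)
  finally show ?thesis .
qed

lemma nn_integral_gauss_homogeneous:
  fixes h :: "'a::euclidean_space \<Rightarrow> ennreal"
  assumes [measurable]: "h \<in> borel_measurable borel"
    and h: "\<And>c x. c > 0 \<Longrightarrow> h (c *\<^sub>R x) = h x"
    and S: "(\<integral>\<^sup>+x. h x * indicator (ball 0 1) x \<partial>lborel) < \<infinity>"
  shows "(\<integral>\<^sup>+x. h x * ennreal (norm x ^ j * exp (- (norm x)\<^sup>2)) \<partial>lborel) 
     = (\<integral>\<^sup>+x. h x * indicator (ball 0 1) x \<partial>lborel) 
       * ennreal (real DIM('a) * half_gauss (j + DIM('a) - 1))"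
proof -
  have "(\<integral>\<^sup>+x. h x * ennreal (norm x ^ j * exp (- (norm x)\<^sup>2)) \<partial>lborel)
    = (\<integral>\<^sup>+x. h x * indicator (ball 0 1) x \<partial>lborel)
     * (\<integral>\<^sup>+r. ennreal (real DIM('a) * r ^ (DIM('a) - 1)) * indicator {0..} r * ennreal (r ^ j * exp (- r\<^sup>2)) \<partial>lborel)"
    by (rule nn_integral_polar[OF _ _ h S]) measurable
  also have "(\<integral>\<^sup>+r. ennreal (real DIM('a) * r ^ (DIM('a) - 1)) * indicator {0..} r * ennreal (r ^ j * exp (- r\<^sup>2)) \<partial>lborel)
    = (\<integral>\<^sup>+r. ennreal (real DIM('a)) * (indicator {0..} r * ennreal (exp (- r\<^sup>2) * r ^ (j + DIM('a) - 1))) \<partial>lborel)"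
  proof (intro nn_integral_cong)
    fix r :: real
    have "r ^ (j + DIM('a) - 1) = r ^ j * r ^ (DIM('a) - 1)"
      by (simp flip: power_add add: add.commute)
    then show "ennreal (real DIM('a) * r ^ (DIM('a) - 1)) * indicator {0..} r * ennreal (r ^ j * exp (- r\<^sup>2))
      = ennreal (real DIM('a)) * (indicator {0..} r * ennreal (exp (- r\<^sup>2) * r ^ (j + DIM('a) - 1)))"
      by (auto simp: indicator_def mult_ac simp flip: ennreal_mult')
  qed
  also have "\<dots> = ennreal (real DIM('a) * half_gauss (j + DIM('a) - 1))"
    by (subst nn_integral_cmult) (simp, simp only: nn_integral_half_gauss ennreal_mult'[OF of_nat_0_le_iff])
  finally show ?thesis .
qed

section \<open>Gaussian moments along a unit vector\<close>

lemma nn_integral_lborel_shift: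
  fixes f :: "'a::euclidean_space \<Rightarrow> ennreal"
  assumes "f \<in> borel_measurable borel"
  shows "(\<integral>\<^sup>+x. f x \<partial>lborel) = (\<integral>\<^sup>+x. f (t + x) \<partial>lborel)"
  using nn_integral_lborel_scale[OF assms, of 1 t] by simp

text \<open>The total mass pi^(DIM/2) of exp(-|x|^2), left unevaluated because it cancels from the
  ratio of consecutive sphere moments.\<close>

definition gauss_mass :: "'a::euclidean_space itself \<Rightarrow> real" where
  "gauss_mass _ = unit_ball_vol DIM('a) * real DIM('a) * half_gauss (DIM('a) - 1)"

lemma gauss_mass_pos: "gauss_mass TYPE('a::euclidean_space) > 0"
  by (simp add: gauss_mass_def half_gauss_pos)

lemma nn_integral_gauss:
  "(\<integral>\<^sup>+x. ennreal (exp (- (norm (x::'a::euclidean_space))\<^sup>2)) \<partial>lborel) = ennreal (gauss_mass TYPE('a))"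
proof -
  have 1: "(\<integral>\<^sup>+x. 1 * indicator (ball (0::'a) 1) x \<partial>lborel) = ennreal (unit_ball_vol DIM('a))"
    by (simp add: emeasure_ball)
  have "(\<integral>\<^sup>+x. 1 * ennreal (norm (x::'a) ^ 0 * exp (- (norm x)\<^sup>2)) \<partial>lborel) 
    = ennreal (unit_ball_vol DIM('a)) * ennreal (real DIM('a) * half_gauss (0 + DIM('a) - 1))"
    by (subst nn_integral_gauss_homogeneous) (simp_all only: 1, simp_all)
  then show ?thesis by (simp add: gauss_mass_def mult.assoc ennreal_mult' flip: ennreal_mult')
qed

text \<open>Completing the square: 2 s (x . mu) - |x|^2 = s^2 - |x - s mu|^2, and Lebesgue measure
  is translation invariant.\<close>

lemma nn_integral_gauss_exp:
  fixes \<mu> :: "'a::euclidean_space"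
  assumes "norm \<mu> = 1"
  shows "(\<integral>\<^sup>+x. ennreal (exp (2 * s * (x \<bullet> \<mu>)) * exp (- (norm x)\<^sup>2)) \<partial>lborel) 
    = ennreal (exp (s\<^sup>2) * gauss_mass TYPE('a))"
proof -
  have "exp (2 * s * ((s *\<^sub>R \<mu> + x) \<bullet> \<mu>)) * exp (- (norm (s *\<^sub>R \<mu> + x))\<^sup>2) = exp (s\<^sup>2) * exp (- (norm x)\<^sup>2)" for x
  proof -
    have "(norm (s *\<^sub>R \<mu> + x))\<^sup>2 = s\<^sup>2 + 2 * s * (x \<bullet> \<mu>) + (norm x)\<^sup>2"
      using assms unfolding norm_eq_1 power2_norm_eq_inner
      by (simp add: algebra_simps inner_commute power2_eq_square)
    then show ?thesis
      using assms unfolding exp_add[symmetric] norm_eq_1 by (simp add: algebra_simps power2_eq_square)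
  qed
  then have "(\<integral>\<^sup>+x. ennreal (exp (2 * s * (x \<bullet> \<mu>)) * exp (- (norm x)\<^sup>2)) \<partial>lborel) 
    = (\<integral>\<^sup>+x. ennreal (exp (s\<^sup>2) * exp (- (norm (x::'a))\<^sup>2)) \<partial>lborel)"
    by (subst nn_integral_lborel_shift[of _ "s *\<^sub>R \<mu>"]) auto
  also have "\<dots> = ennreal (exp (s\<^sup>2)) * (\<integral>\<^sup>+x. ennreal (exp (- (norm (x::'a))\<^sup>2)) \<partial>lborel)"
    by (subst nn_integral_cmult[symmetric]) (auto simp: ennreal_mult)
  finally show ?thesis by (simp add: nn_integral_gauss ennreal_mult')
qed

text \<open>The even part in s has a power series with nonnegative terms, which can be integrated
  term by term in \<open>ennreal\<close>.\<close>

lemma nn_integral_gauss_cosh: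
  fixes \<mu> :: "'a::euclidean_space"
  assumes "norm \<mu> = 1"
  shows "(\<integral>\<^sup>+x. ennreal (cosh (2 * s * (x \<bullet> \<mu>)) * exp (- (norm x)\<^sup>2)) \<partial>lborel) 
    = ennreal (exp (s\<^sup>2) * gauss_mass TYPE('a))"
proof -
  let ?f = "\<lambda>s x. exp (2 * s * (x \<bullet> \<mu>)) * exp (- (norm (x::'a))\<^sup>2)"
  have "(\<integral>\<^sup>+x. ennreal (cosh (2 * s * (x \<bullet> \<mu>)) * exp (- (norm x)\<^sup>2)) \<partial>lborel) 
    = (\<integral>\<^sup>+x. ennreal (1/2) * (ennreal (?f s x) + ennreal (?f (-s) x)) \<partial>lborel)"
  proof (intro nn_integral_cong)
    fix x
    have "cosh (2 * s * (x \<bullet> \<mu>)) * exp (- (norm x)\<^sup>2) = 1 / 2 * (?f s x + ?f (-s) x)"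
      by (simp add: cosh_def field_simps)
    then show "ennreal (cosh (2 * s * (x \<bullet> \<mu>)) * exp (- (norm x)\<^sup>2)) = ennreal (1/2) * (ennreal (?f s x) + ennreal (?f (-s) x))"
      by (subst ennreal_plus[symmetric], simp, simp, subst ennreal_mult'[symmetric]) simp_all
  qed
  also have "\<dots> = ennreal (1/2) * ((\<integral>\<^sup>+x. ennreal (?f s x) \<partial>lborel) + (\<integral>\<^sup>+x. ennreal (?f (-s) x) \<partial>lborel))"
    by (subst nn_integral_cmult, measurable, subst nn_integral_add) auto
  also have "\<dots> = ennreal (exp (s\<^sup>2) * gauss_mass TYPE('a))"
  proof -
    have "exp (s\<^sup>2) * gauss_mass TYPE('a) \<ge> 0"
      using gauss_mass_pos[where ?'a='a] by simp
    note * = ennreal_plus[OF this this, symmetric]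
    show ?thesis
      unfolding nn_integral_gauss_exp[OF assms] power2_minus *
      by (subst ennreal_mult'[symmetric]) (simp_all add: mult.commute)
  qed
  finally show ?thesis .
qed

text \<open>Once the coefficients of the difference below n are known to be zero, the n-th one is
  the limit at 0 of the difference divided by x^n.\<close>

lemma powser_unique_real:
  fixes a b :: "nat \<Rightarrow> real"
  assumes a: "\<And>x. (\<lambda>n. a n * x ^ n) sums f x" and b: "\<And>x. (\<lambda>n. b n * x ^ n) sums f x"
  shows "a = b"
proof -
  define c where "c n = a n - b n" for n
  have c: "(\<lambda>n. c n * x ^ n) sums 0" for x
    using sums_diff[OF a b, of x x] by (simp add: c_def algebra_simps)
  have "c n = 0" for n
  proof (induction n rule: less_induct)
    case (less n)
    have "(\<lambda>k. c (k + n) * x ^ k) sums 0" if "x \<noteq> 0" for x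
    proof -
      have "(\<lambda>k. c (k + n) * x ^ (k + n)) sums (0 - (\<Sum>i<n. c i * x ^ i))"
        by (rule sums_split_initial_segment[OF c])
      then have "(\<lambda>k. c (k + n) * x ^ (k + n) / x ^ n) sums (0 / x ^ n)"
        using less by (intro sums_divide) simp
      then show ?thesis using that by (simp add: power_add)
    qed
    then have "((\<lambda>x. 0) \<longlongrightarrow> c (0 + n)) (at (0::real))"
      by (intro powser_limit_0_strong[of 1 "\<lambda>k. c (k + n)"]) auto
    then show "c n = 0" using tendsto_unique[OF at_neq_bot _ tendsto_const] by force
  qed
  then show ?thesis by (auto simp: c_def fun_eq_iff)
qed

text \<open>Both sides of \<open>nn_integral_gauss_cosh\<close> are power series in s; the
  coefficients of s^(2j) are 4^j m_j / (2j)! on the left and G / j! on the right.\<close>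

lemma nn_integral_gauss_moment:
  fixes \<mu> :: "'a::euclidean_space"
  assumes \<mu>: "norm \<mu> = 1"
  shows "(\<integral>\<^sup>+x. ennreal ((x \<bullet> \<mu>) ^ (2 * j) * exp (- (norm x)\<^sup>2)) \<partial>lborel) 
    = ennreal (fact (2 * j) / (4 ^ j * fact j) * gauss_mass TYPE('a))"
proof -
  define G where "G = gauss_mass TYPE('a)"
  have G: "G > 0" by (simp add: G_def gauss_mass_pos)
  define M where "M n = (\<integral>\<^sup>+x. ennreal ((x \<bullet> \<mu>) ^ (2 * n) * exp (- (norm x)\<^sup>2)) \<partial>lborel)" for n
  define t where "t s n = (2 * s) ^ (2 * n) / fact (2 * n)" for s :: real and n
  have t0: "t s n \<ge> 0" for s n by (simp add: t_def)
  have series: "(\<Sum>n. ennreal (t s n) * M n) = ennreal (exp (s\<^sup>2) * G)" for s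
  proof -
    have "(\<Sum>n. ennreal (t s n) * M n) 
      = (\<Sum>n. (\<integral>\<^sup>+x. ennreal (t s n) * ennreal ((x \<bullet> \<mu>) ^ (2 * n) * exp (- (norm x)\<^sup>2)) \<partial>lborel))"
      unfolding M_def by (subst nn_integral_cmult) auto
    also have "\<dots> = (\<integral>\<^sup>+x. (\<Sum>n. ennreal (t s n) * ennreal ((x \<bullet> \<mu>) ^ (2 * n) * exp (- (norm x)\<^sup>2))) \<partial>lborel)"
      by (subst nn_integral_suminf) auto
    also have "\<dots> = (\<integral>\<^sup>+x. ennreal (cosh (2 * s * (x \<bullet> \<mu>)) * exp (- (norm x)\<^sup>2)) \<partial>lborel)"
    proof (intro nn_integral_cong)
      fix x :: 'a
      define y where "y = 2 * s * (x \<bullet> \<mu>)"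
      have "(\<lambda>n. if even n then y ^ n /\<^sub>R fact n else 0) sums cosh y" by (rule cosh_converges)
      then have "(\<lambda>n. y ^ (2 * n) /\<^sub>R fact (2 * n)) sums cosh y"
        by (subst (asm) sums_mono_reindex[of "\<lambda>n. 2 * n", symmetric])
           (auto simp: strict_mono_def elim!: evenE)
      then have "(\<lambda>n. y ^ (2 * n) /\<^sub>R fact (2 * n) * exp (- (norm x)\<^sup>2)) sums (cosh y * exp (- (norm x)\<^sup>2))"
        by (rule sums_mult2)
      moreover have "y ^ (2 * n) /\<^sub>R fact (2 * n) * exp (- (norm x)\<^sup>2) = t s n * ((x \<bullet> \<mu>) ^ (2 * n) * exp (- (norm x)\<^sup>2))" for n
        by (simp add: y_def t_def power_mult_distrib divide_inverse)
      ultimately have "(\<lambda>n. t s n * ((x \<bullet> \<mu>) ^ (2 * n) * exp (- (norm x)\<^sup>2))) sums (cosh y * exp (- (norm x)\<^sup>2))"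
        by (simp only:)
      then have "(\<Sum>n. ennreal (t s n * ((x \<bullet> \<mu>) ^ (2 * n) * exp (- (norm x)\<^sup>2)))) = ennreal (cosh y * exp (- (norm x)\<^sup>2))"
        using t0 by (intro suminf_ennreal_eq) auto
      then show "(\<Sum>n. ennreal (t s n) * ennreal ((x \<bullet> \<mu>) ^ (2 * n) * exp (- (norm x)\<^sup>2))) 
         = ennreal (cosh (2 * s * (x \<bullet> \<mu>)) * exp (- (norm x)\<^sup>2))"
        using t0 by (simp add: y_def ennreal_mult')
    qed
    finally show ?thesis unfolding nn_integral_gauss_cosh[OF \<mu>] G_def .
  qed
  have fin: "M n < \<infinity>" for n
  proof -
    have "ennreal (t 1 n) * M n \<le> (\<Sum>n. ennreal (t 1 n) * M n)"
      using sum_le_suminf[of "\<lambda>n. ennreal (t 1 n) * M n" "{n}"] by simp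
    also have "\<dots> < \<infinity>" unfolding series by simp
    finally show ?thesis by (auto simp: ennreal_mult_less_top t_def)
  qed
  define m where "m n = enn2real (M n)" for n
  have Mm: "M n = ennreal (m n)" for n using fin[of n] by (simp add: m_def)
  have m0: "m n \<ge> 0" for n by (simp add: m_def)
  have sums1: "(\<lambda>n. t s n * m n) sums (exp (s\<^sup>2) * G)" for s
  proof -
    have "(\<Sum>n. ennreal (t s n * m n)) = ennreal (exp (s\<^sup>2) * G)"
      using series[of s] t0 by (simp add: Mm ennreal_mult')
    moreover from this have "summable (\<lambda>n. t s n * m n)" using t0 m0
      by (intro summable_suminf_not_top) auto
    ultimately show ?thesis using t0 m0 G
      by (auto simp: suminf_ennreal2 sums_iff suminf_nonneg ennreal_inj)
  qed
  \<comment> \<open>Zeros are interleaved at odd exponents so that uniqueness for series in s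
    applies.\<close>
  define A where "A n = (if even n then 2 ^ n * m (n div 2) / fact n else 0)" for n
  define B where "B n = (if even n then G / fact (n div 2) else 0)" for n
  have "A = B"
  proof (rule powser_unique_real)
    fix s :: real
    have "(\<lambda>n. A (2 * n) * s ^ (2 * n)) sums (exp (s\<^sup>2) * G)"
      using sums1[of s] by (simp add: A_def t_def power_mult_distrib mult_ac)
    then show "(\<lambda>n. A n * s ^ n) sums (exp (s\<^sup>2) * G)"
      by (subst sums_mono_reindex[of "\<lambda>n. 2 * n", symmetric])
         (auto simp: strict_mono_def A_def elim!: evenE)
    have "(\<lambda>n. (s\<^sup>2) ^ n /\<^sub>R fact n * G) sums (exp (s\<^sup>2) * G)"
      by (intro sums_mult2 exp_converges)
    then have "(\<lambda>n. B (2 * n) * s ^ (2 * n)) sums (exp (s\<^sup>2) * G)"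
      unfolding power_mult[of s 2] by (simp add: B_def divide_inverse mult_ac)
    then show "(\<lambda>n. B n * s ^ n) sums (exp (s\<^sup>2) * G)"
      by (subst sums_mono_reindex[of "\<lambda>n. 2 * n", symmetric])
         (auto simp: strict_mono_def B_def elim!: evenE)
  qed
  then have "A (2 * j) = B (2 * j)" by simp
  moreover have "(2::real) ^ (2 * j) = 4 ^ j" by (simp only: power_mult) simp
  ultimately have "m j = fact (2 * j) / (4 ^ j * fact j) * G"
    unfolding A_def B_def by (simp del: power_even_eq power_mult add: field_simps)
  then show ?thesis using Mm[of j] by (simp add: M_def G_def)
qed

section \<open>Moments of the uniform law on the sphere\<close>

lemma space_sphere_measure [simp]: "space sphere_measure = UNIV"
  and sets_sphere_measure [simp, measurable_cong]: "sets sphere_measure = sets borel"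
  by (simp_all add: sphere_measure_def)

lemma nn_integral_sphere:
  fixes f :: "'a::euclidean_space \<Rightarrow> ennreal"
  assumes [measurable]: "f \<in> borel_measurable borel"
  shows "(\<integral>\<^sup>+x. f x \<partial>sphere_measure) 
    = ennreal (real DIM('a)) * (\<integral>\<^sup>+x. f (x /\<^sub>R norm x) * indicator (ball 0 1) x \<partial>lborel)"
proof -
  have meas: "(\<lambda>x::'a. x /\<^sub>R norm x) \<in> borel_measurable borel" by measurable
  have [measurable]: "(\<lambda>x::'a. x /\<^sub>R norm x) \<in> borel_measurable (restrict_space lborel (ball 0 1 - {0}))"
    by (rule measurable_restrict_space1) (use meas in simp)
  have "(\<integral>\<^sup>+x. f x \<partial>sphere_measure) 
    = ennreal (real DIM('a)) * (\<integral>\<^sup>+x. f (x /\<^sub>R norm x) \<partial>restrict_space lborel (ball 0 1 - {0}))"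
    unfolding sphere_measure_def
    by (simp add: nn_integral_density nn_integral_cmult nn_integral_distr)
  also have "(\<integral>\<^sup>+x. f (x /\<^sub>R norm x) \<partial>restrict_space lborel (ball 0 1 - {0})) 
    = (\<integral>\<^sup>+x. f (x /\<^sub>R norm x) * indicator (ball 0 1 - {0}) x \<partial>lborel)"
    by (subst nn_integral_restrict_space) auto
  also have "\<dots> = (\<integral>\<^sup>+x. f (x /\<^sub>R norm x) * indicator (ball 0 1) x \<partial>lborel)"
    by (intro nn_integral_cong_AE eventually_mono[OF AE_lborel_singleton[of 0]])
       (auto simp: indicator_def)
  finally show ?thesis .
qed

text \<open>The cone measure has total mass DIM times the volume of the unit ball; Gamma(x + 1) = x
  Gamma(x) at x = DIM/2 turns this into \<open>omega\<close>.\<close>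

lemma emeasure_sphere_measure_UNIV:
  "emeasure (sphere_measure :: 'a::euclidean_space measure) UNIV = ennreal (omega (DIM('a) - 1))"
proof -
  have "emeasure (sphere_measure :: 'a measure) UNIV = (\<integral>\<^sup>+x. 1 \<partial>(sphere_measure :: 'a measure))"
    by simp
  also have "\<dots> = ennreal (real DIM('a)) * ennreal (unit_ball_vol (real DIM('a)))"
    by (subst nn_integral_sphere) (simp_all add: emeasure_ball)
  also have "\<dots> = ennreal (real DIM('a) * unit_ball_vol (real DIM('a)))"
    by (simp add: ennreal_mult')
  also have "real DIM('a) * unit_ball_vol (real DIM('a)) = omega (DIM('a) - 1)"
  proof -
    have 1: "real (DIM('a) - 1) + 1 = real DIM('a)" using DIM_positive[where 'a='a] by linarith
    have 2: "Gamma (real DIM('a) / 2 + 1) = real DIM('a) / 2 * Gamma (real DIM('a) / 2)"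
      using DIM_positive[where 'a='a] by (intro Gamma_plus1) (auto dest!: nonpos_Ints_nonpos)
    show ?thesis unfolding omega_def unit_ball_vol_def 1 2 by simp
  qed
  finally show ?thesis .
qed

lemma omega_pos: "omega d > 0"
  by (simp add: omega_def)

interpretation sphere: finite_measure "sphere_measure :: 'a::euclidean_space measure"
  by standard (simp add: emeasure_sphere_measure_UNIV)

lemma AE_sphere_measure: "AE x in (sphere_measure :: 'a::euclidean_space measure). norm x = 1"
proof -
  have "emeasure sphere_measure {x::'a. norm x \<noteq> 1} = (\<integral>\<^sup>+x. indicator {x::'a. norm x \<noteq> 1} x \<partial>sphere_measure)"
    by (rule nn_integral_indicator[symmetric]) simp
  also have "\<dots> = ennreal (real DIM('a)) * (\<integral>\<^sup>+x. indicator {x::'a. norm x \<noteq> 1} (x /\<^sub>R norm x) * indicator (ball 0 1) x \<partial>lborel)"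
    by (rule nn_integral_sphere) simp
  also have "(\<integral>\<^sup>+x. indicator {x::'a. norm x \<noteq> 1} (x /\<^sub>R norm x) * indicator (ball 0 1) x \<partial>lborel)
     = (\<integral>\<^sup>+x. 0 \<partial>(lborel :: 'a measure))"
    by (intro nn_integral_cong_AE eventually_mono[OF AE_lborel_singleton[of 0]]) auto
  finally have "emeasure sphere_measure {x::'a. norm x \<noteq> 1} = 0" by simp
  then show ?thesis by (intro AE_I[of _ _ "{x. norm x \<noteq> 1}"]) auto
qed

text \<open>Inherited from the invariance of Lebesgue measure under x -> -x. It settles the odd
  moments, whose integrands change sign and so escape the nonnegative Gaussian integrals.\<close>

lemma distr_sphere_measure_uminus:
  "distr sphere_measure borel uminus = (sphere_measure :: 'a::euclidean_space measure)"
proof (rule measure_eqI)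
  fix A :: "'a set" assume "A \<in> sets (distr sphere_measure borel uminus)"
  then have [measurable]: "A \<in> sets borel" by simp
  have [measurable]: "(\<lambda>x::'a. indicator A (- x) :: ennreal) \<in> borel_measurable borel" by measurable
  have meas: "(\<lambda>x::'a. indicator A (- (x /\<^sub>R norm x)) * indicator (ball 0 1) x :: ennreal) \<in> borel_measurable borel"
    by measurable simp
  have "emeasure (distr sphere_measure borel uminus) A = (\<integral>\<^sup>+x. indicator A (-x) \<partial>sphere_measure)"
    by (simp add: nn_integral_distr flip: nn_integral_indicator)
  also have "\<dots> = (\<integral>\<^sup>+x. indicator A x \<partial>sphere_measure)"
  proof -
    have "indicator (ball 0 1) (- x) = (indicator (ball 0 1) x :: ennreal)" for x :: 'a
      by (simp add: indicator_def)
    then show ?thesis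
      using nn_integral_lborel_scale[OF meas, of "-1" 0]
      by (simp add: nn_integral_sphere del: nn_integral_indicator)
  qed
  finally show "emeasure (distr sphere_measure borel uminus) A = emeasure sphere_measure A" by simp
qed simp

lemma integrable_sphere_poly [simp]:
  fixes \<mu> :: "'a::euclidean_space"
  assumes "norm \<mu> = 1"
  shows "integrable sphere_measure (\<lambda>x. poly p (x \<bullet> \<mu>))"
proof -
  have "continuous_on {-1..1} (poly p)" by (intro continuous_intros)
  then have "bounded (poly p ` {-1..1})" by (intro compact_imp_bounded compact_continuous_image) auto
  then obtain B where B: "\<forall>t\<in>{-1..1}. \<bar>poly p t\<bar> \<le> B"
    by (auto simp: bounded_iff)
  show ?thesis
  proof (rule sphere.integrable_const_bound[of _ B])
    show "AE x in sphere_measure. norm (poly p (x \<bullet> \<mu>)) \<le> B"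
      using AE_sphere_measure
    proof eventually_elim
      case (elim x)
      then have "\<bar>x \<bullet> \<mu>\<bar> \<le> 1" using Cauchy_Schwarz_ineq2[of x \<mu>] assms by simp
      then show ?case using B by (auto simp: abs_le_iff)
    qed
    show "(\<lambda>x. poly p (x \<bullet> \<mu>)) \<in> borel_measurable sphere_measure" 
      by (simp add: measurable_def[symmetric] continuous_intros borel_measurable_continuous_onI cong: measurable_cong_sets)
  qed
qed

definition sphere_moment :: "'a::euclidean_space \<Rightarrow> nat \<Rightarrow> real" where
  "sphere_moment \<mu> k = (\<integral>x. (x \<bullet> \<mu>) ^ k \<partial>sphere_measure)"

lemma sphere_moment_odd:
  fixes \<mu> :: "'a::euclidean_space"
  assumes "odd k"
  shows "sphere_moment \<mu> k = 0"
proof -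
  have "sphere_moment \<mu> k = (\<integral>x. (x \<bullet> \<mu>) ^ k \<partial>distr sphere_measure borel uminus)"
    by (simp add: sphere_moment_def distr_sphere_measure_uminus)
  also have "\<dots> = - sphere_moment \<mu> k"
    using assms by (subst integral_distr) (simp_all add: sphere_moment_def)
  finally show ?thesis by simp
qed

text \<open>Away from 0, (x . mu)^(2j) = |x|^(2j) h(x) with h homogeneous of degree 0, so the
  Gaussian moment along mu factors into the sphere moment and the radial integral
  \<open>half_gauss\<close>.\<close>

lemma sphere_moment_even:
  fixes \<mu> :: "'a::euclidean_space"
  assumes \<mu>: "norm \<mu> = 1"
  shows "sphere_moment \<mu> (2 * j) * half_gauss (2 * j + DIM('a) - 1) 
    = fact (2 * j) / (4 ^ j * fact j) * gauss_mass TYPE('a)"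
proof -
  define h where "h x = ennreal (((x /\<^sub>R norm x) \<bullet> \<mu>) ^ (2 * j))" for x :: 'a
  have [measurable]: "h \<in> borel_measurable borel" unfolding h_def by measurable
  have h: "h (c *\<^sub>R x) = h x" if "c > 0" for c x
  proof -
    have "(c *\<^sub>R x) /\<^sub>R norm (c *\<^sub>R x) = x /\<^sub>R norm x" using that by (simp add: field_simps)
    then show ?thesis by (simp only: h_def)
  qed
  define S where "S = (\<integral>\<^sup>+x. h x * indicator (ball 0 1) x \<partial>lborel)"
  have sphere: "(\<integral>\<^sup>+x. ennreal ((x \<bullet> \<mu>) ^ (2 * j)) \<partial>sphere_measure) = ennreal (real DIM('a)) * S"
    unfolding S_def h_def by (rule nn_integral_sphere) simp
  have int: "integrable sphere_measure (\<lambda>x. (x \<bullet> \<mu>) ^ (2 * j))"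
    using integrable_sphere_poly[OF \<mu>, of "monom 1 (2 * j)"] by (simp add: poly_monom)
  have mom: "ennreal (sphere_moment \<mu> (2 * j)) = ennreal (real DIM('a)) * S"
    unfolding sphere_moment_def sphere[symmetric]
    by (rule nn_integral_eq_integral[symmetric]) (use int in auto)
  then have fin: "S < \<infinity>"
    by (metis DIM_positive ennreal_mult_eq_top_iff ennreal_neq_top infinity_ennreal_def less_top 
        ennreal_eq_0_iff of_nat_0_less_iff not_le)
  have "(\<integral>\<^sup>+x. h x * ennreal (norm x ^ (2 * j) * exp (- (norm x)\<^sup>2)) \<partial>lborel) 
     = S * ennreal (real DIM('a) * half_gauss (2 * j + DIM('a) - 1))"
    unfolding S_def by (rule nn_integral_gauss_homogeneous) (use h fin in \<open>simp_all add: S_def\<close>)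
  also have "\<dots> = ennreal (sphere_moment \<mu> (2 * j) * half_gauss (2 * j + DIM('a) - 1))"
  proof -
    have "S * ennreal (real DIM('a) * half_gauss (2 * j + DIM('a) - 1)) 
      = (ennreal (real DIM('a)) * S) * ennreal (half_gauss (2 * j + DIM('a) - 1))"
      by (subst ennreal_mult') (simp_all only: of_nat_0_le_iff mult_ac)
    then show ?thesis
      unfolding mom[symmetric] by (subst ennreal_mult'') (simp_all add: half_gauss_pos less_imp_le)
  qed
  also have "(\<integral>\<^sup>+x. h x * ennreal (norm x ^ (2 * j) * exp (- (norm x)\<^sup>2)) \<partial>lborel)
    = (\<integral>\<^sup>+x. ennreal ((x \<bullet> \<mu>) ^ (2 * j) * exp (- (norm x)\<^sup>2)) \<partial>lborel)"
  proof (intro nn_integral_cong_AE eventually_mono[OF AE_lborel_singleton[of 0]])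
    fix x :: 'a assume "x \<noteq> 0"
    then have "((x /\<^sub>R norm x) \<bullet> \<mu>) ^ (2 * j) * (norm x ^ (2 * j) * exp (- (norm x)\<^sup>2)) = (x \<bullet> \<mu>) ^ (2 * j) * exp (- (norm x)\<^sup>2)"
      by (simp add: field_simps)
    then show "h x * ennreal (norm x ^ (2 * j) * exp (- (norm x)\<^sup>2)) = ennreal ((x \<bullet> \<mu>) ^ (2 * j) * exp (- (norm x)\<^sup>2))"
      by (simp add: h_def flip: ennreal_mult')
  qed
  also have "\<dots> = ennreal (fact (2 * j) / (4 ^ j * fact j) * gauss_mass TYPE('a))"
    by (rule nn_integral_gauss_moment[OF \<mu>])
  finally show ?thesis
    by (subst (asm) ennreal_inj) 
       (auto simp: sphere_moment_def half_gauss_pos gauss_mass_pos less_imp_le intro!: mult_nonneg_nonneg)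
qed

text \<open>For k = 2j, passing from j to j + 1 multiplies the radial factor by (k + DIM)/2 and the
  Gaussian moment by (k + 1)/2.\<close>

lemma sphere_moment_rec:
  fixes \<mu> :: "'a::euclidean_space"
  assumes \<mu>: "norm \<mu> = 1"
  shows "(real k + real DIM('a)) * sphere_moment \<mu> (k + 2) = (real k + 1) * sphere_moment \<mu> k"
proof (cases "even k")
  case False
  then show ?thesis by (simp add: sphere_moment_odd)
next
  case True
  then obtain j where k: "k = 2 * j" by (elim evenE)
  define g where "g = half_gauss (2 * j + DIM('a) - 1)"
  have g: "g > 0" by (simp add: g_def half_gauss_pos)
  have "2 * (j + 1) + DIM('a) - 1 = (2 * j + DIM('a) - 1) + 2" using DIM_positive[where 'a='a] by arith
  then have hg: "2 * half_gauss (2 * (j + 1) + DIM('a) - 1) = (real k + real DIM('a)) * g"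
    using half_gauss_rec[of "2 * j + DIM('a) - 1"] DIM_positive[where 'a='a] by (simp add: g_def k)
  have e: "fact (2 * (j + 1)) / (4 ^ (j + 1) * fact (j + 1)) = (2 * real j + 1) / 2 * (fact (2 * j) / (4 ^ j * fact j))"
  proof -
    have "fact (2 * (j + 1)) = (2 * real j + 2) * (2 * real j + 1) * fact (2 * j)"
      and "fact (j + 1) = (real j + 1) * fact j" by (simp_all add: algebra_simps)
    moreover have "real j + 1 \<noteq> 0" by linarith
    ultimately show ?thesis
      by (simp del: fact_Suc add: divide_simps power_add)
  qed
  have "((real k + real DIM('a)) * sphere_moment \<mu> (k + 2)) * g = 2 * (sphere_moment \<mu> (2 * (j + 1)) * half_gauss (2 * (j + 1) + DIM('a) - 1))"
    using hg by (simp add: k mult_ac)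
  also have "\<dots> = ((real k + 1) * sphere_moment \<mu> k) * g"
  proof -
    have "2 * (sphere_moment \<mu> (2 * (j + 1)) * half_gauss (2 * (j + 1) + DIM('a) - 1))
        = (2 * real j + 1) * (fact (2 * j) / (4 ^ j * fact j) * gauss_mass TYPE('a))"
      unfolding sphere_moment_even[OF \<mu>] e by simp
    also have "\<dots> = (2 * real j + 1) * (sphere_moment \<mu> (2 * j) * g)"
      unfolding sphere_moment_even[OF \<mu>, of j, folded g_def] ..
    finally show ?thesis by (simp add: k)
  qed
  finally show ?thesis using g by simp
qed

lemma poly_induct_monom:
  assumes "\<And>p q. P p \<Longrightarrow> P q \<Longrightarrow> P (p + q)" "\<And>a n. P (monom a n)"
  shows "P p"
proof -
  have "P (\<Sum>i\<in>A. monom (coeff p i) i)" if "finite A" for A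
    using that by induction (use assms assms(2)[of 0] in auto)
  then have "P (\<Sum>i\<le>degree p. monom (coeff p i) i)" by simp
  then show ?thesis by (simp only: poly_as_sum_of_monoms)
qed

definition sphere_mean :: "'a::euclidean_space \<Rightarrow> real poly \<Rightarrow> real" where
  "sphere_mean \<mu> p = (\<integral>x. poly p (x \<bullet> \<mu>) \<partial>sphere_measure) / omega (DIM('a) - 1)"

text \<open>The integration by parts rule is linear in p, so monomials suffice: for t^(m+1) it is
  \<open>sphere_moment_rec\<close>, and for constants it says that the first moment is zero.\<close>

lemma gegen_functional_sphere_mean:
  fixes \<mu> :: "'a::euclidean_space"
  assumes \<mu>: "norm \<mu> = 1" and dim: "DIM('a) \<ge> 2"
  shows "gegen_functional ((real (DIM('a) - 1) - 1) / 2) (sphere_mean \<mu>)"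
proof
  show "(real (DIM('a) - 1) - 1) / 2 \<ge> 0" using dim by simp
  show add: "sphere_mean \<mu> (p + q) = sphere_mean \<mu> p + sphere_mean \<mu> q" for p q
    by (simp add: sphere_mean_def \<mu> add_divide_distrib)
  show smult: "sphere_mean \<mu> (smult c p) = c * sphere_mean \<mu> p" for c p
    by (simp add: sphere_mean_def)
  have "measure (sphere_measure :: 'a measure) UNIV = omega (DIM('a) - 1)"
    by (simp add: measure_def emeasure_sphere_measure_UNIV omega_pos less_imp_le)
  then show "sphere_mean \<mu> 1 = 1"
    using omega_pos[of "DIM('a) - 1"] by (simp add: sphere_mean_def)
  have mono: "sphere_mean \<mu> (monom a k) = a * sphere_moment \<mu> k / omega (DIM('a) - 1)" for a k
    by (simp add: sphere_mean_def sphere_moment_def poly_monom)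
  have diff: "sphere_mean \<mu> (p - q) = sphere_mean \<mu> p - sphere_mean \<mu> q" for p q
    by (simp add: sphere_mean_def \<mu> diff_divide_distrib)
  fix p
  show "sphere_mean \<mu> ([:1, 0, -1:] * pderiv p) = (2 * ((real (DIM('a) - 1) - 1) / 2) + 1) * sphere_mean \<mu> ([:0, 1:] * p)"
  proof (induction p rule: poly_induct_monom)
    case (1 p q)
    then show ?case by (simp only: pderiv_add distrib_left add)
  next
    case (2 a n)
    show ?case
    proof (cases n)
      case 0
      have "[:0, 1:] * monom a n = monom a (Suc 0)" using 0 by (simp add: monom_Suc)
      moreover have "pderiv (monom a n) = 0" using 0 by (simp add: pderiv_monom)
      ultimately show ?thesis using mono[of 0 0] by (simp add: mono sphere_moment_odd)
    next
      case (Suc m)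
      have 1: "[:0, 1:] * monom a n = monom a (m + 2)" using Suc by (simp add: monom_Suc)
      have 2: "[:1, 0, -1:] * pderiv (monom a n) = monom (a * real n) m - monom (a * real n) (m + 2)"
      proof -
        have "pderiv (monom a n) = monom (a * real n) m" by (simp add: Suc pderiv_monom mult.commute)
        moreover have "[:1, 0, -1:] * monom b m = monom b m - monom b (m + 2)" for b :: real
          by (simp add: monom_Suc)
        ultimately show ?thesis by simp
      qed
      have "real (DIM('a) - 1) = real DIM('a) - 1" using dim by simp
      then have r: "2 * ((real (DIM('a) - 1) - 1) / 2) + 1 = real DIM('a) - 1" by (simp add: field_simps)
      have "real n * (sphere_moment \<mu> m - sphere_moment \<mu> (m + 2)) = (real DIM('a) - 1) * sphere_moment \<mu> (m + 2)"
        using sphere_moment_rec[OF \<mu>, of m] by (simp add: Suc algebra_simps)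
      then have "a * (real n * (sphere_moment \<mu> m - sphere_moment \<mu> (m + 2))) / omega (DIM('a) - 1)
         = a * ((real DIM('a) - 1) * sphere_moment \<mu> (m + 2)) / omega (DIM('a) - 1)" by (simp only:)
      then show ?thesis
        unfolding 1 2 diff mono r by (simp add: algebra_simps diff_divide_distrib)
    qed
  qed
qed

section \<open>Limit theorems\<close>

lemma (in prob_space) strong_law_bounded:
  fixes X :: "nat \<Rightarrow> 'a \<Rightarrow> real"
  assumes indep: "indep_vars (\<lambda>_. borel) X UNIV"
    and bounded: "\<And>i. AE \<omega> in M. \<bar>X i \<omega>\<bar> \<le> B"
    and mean: "\<And>i. expectation (X i) = m"
  shows "AE \<omega> in M. (\<lambda>n. (\<Sum>i<n. X i \<omega>) / real n) \<longlonglongrightarrow> m"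
proof -
  have rv [measurable]: "random_variable borel (X i)" for i
    using indep unfolding indep_vars_def2 by simp
  \<comment> \<open>Strictly positive whatever \<open>B\<close> is, so the Hoeffding interval has
    positive width.\<close>
  define C where "C = \<bar>B\<bar> + 1"
  have C: "C > 0" by (simp add: C_def)
  have hoeff: "prob {\<omega>\<in>space M. \<bar>(\<Sum>i<n. X i \<omega>) / real n - m\<bar> \<ge> e} \<le> 2 * exp (- e\<^sup>2 / (2 * C\<^sup>2)) ^ n"
    if n: "n > 0" and e: "e > 0" for n e
  proof -
    interpret H: Hoeffding_ineq M "{..<n}" X "\<lambda>_. - C" "\<lambda>_. C" "\<Sum>i<n. expectation (X i)"
    proof unfold_locales
      show "indep_vars (\<lambda>_. borel) X {..<n}"
        by (rule indep_vars_subset[OF indep]) simp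
      show "AE x in M. X i x \<in> {- C..C}" for i
        using bounded[of i] by eventually_elim (auto simp: C_def abs_le_iff)
    qed auto
    have "{\<omega>\<in>space M. \<bar>(\<Sum>i<n. X i \<omega>) / real n - m\<bar> \<ge> e} 
      = {\<omega>\<in>space M. \<bar>(\<Sum>i<n. X i \<omega>) - (\<Sum>i<n. expectation (X i))\<bar> \<ge> e * n}"
    proof (intro Collect_cong conj_cong refl)
      fix \<omega>
      have "\<bar>(\<Sum>i<n. X i \<omega>) - (\<Sum>i<n. expectation (X i))\<bar> = \<bar>(\<Sum>i<n. X i \<omega>) / real n - m\<bar> * real n"
      proof -
        have "(\<Sum>i<n. X i \<omega>) - (\<Sum>i<n. expectation (X i)) = ((\<Sum>i<n. X i \<omega>) / real n - m) * real n"
          using n by (simp add: mean field_simps)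
        then show ?thesis by (simp only: abs_mult abs_of_nat)
      qed
      then show "(\<bar>(\<Sum>i<n. X i \<omega>) / real n - m\<bar> \<ge> e) = (\<bar>(\<Sum>i<n. X i \<omega>) - (\<Sum>i<n. expectation (X i))\<bar> \<ge> e * n)"
        using n by simp
    qed
    also have "prob \<dots> \<le> 2 * exp (-2 * (e * n)\<^sup>2 / (\<Sum>i<n. (C - - C)\<^sup>2))"
      by (rule H.Hoeffding_ineq_abs_ge) (use e n C in auto)
    also have "-2 * (e * n)\<^sup>2 / (\<Sum>i<n. (C - - C)\<^sup>2) = real n * (- e\<^sup>2 / (2 * C\<^sup>2))"
      using n C by (simp add: power2_eq_square field_simps)
    also have "exp (real n * (- e\<^sup>2 / (2 * C\<^sup>2))) = exp (- e\<^sup>2 / (2 * C\<^sup>2)) ^ n"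
      by (rule exp_of_nat_mult)
    finally show ?thesis .
  qed
  \<comment> \<open>Tolerances of the form 1/(k+1) suffice, and countably many almost sure events
    can be intersected.\<close>
  have "AE \<omega> in M. \<forall>\<^sub>F n in sequentially. \<bar>(\<Sum>i<n. X i \<omega>) / real n - m\<bar> < 1 / real (Suc k)" for k
  proof -
    define e where "e = 1 / real (Suc k)"
    define A where "A n = {\<omega>\<in>space M. \<bar>(\<Sum>i<n. X i \<omega>) / real n - m\<bar> \<ge> e}" for n
    have e: "e > 0" by (simp add: e_def)
    have "exp (- e\<^sup>2 / (2 * C\<^sup>2)) < 1" using e C by simp
    then have "summable (\<lambda>n. 2 * exp (- e\<^sup>2 / (2 * C\<^sup>2)) ^ n)"
      by (intro summable_mult summable_geometric) simp
    then have "summable (\<lambda>n. measure M (A n))"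
      by (rule summable_comparison_test_ev[rotated])
         (use hoeff e in \<open>auto simp: A_def intro!: eventually_mono[OF eventually_gt_at_top[of 0]]\<close>)
    then have "AE \<omega> in M. \<forall>\<^sub>F n in sequentially. \<omega> \<in> space M - A n"
      by (intro borel_cantelli_AE1) (auto simp: A_def less_top[symmetric])
    then show ?thesis
      by (rule AE_mp) (auto simp: A_def e_def not_le elim!: eventually_mono intro!: AE_I2)
  qed
  then have "AE \<omega> in M. \<forall>k. \<forall>\<^sub>F n in sequentially. \<bar>(\<Sum>i<n. X i \<omega>) / real n - m\<bar> < 1 / real (Suc k)"
    by (simp add: AE_all_countable)
  then show ?thesis
  proof eventually_elim
    case (elim \<omega>)
    show ?case
    proof (rule tendstoI)
      fix e :: real assume "e > 0"
      then obtain k where "1 / real (Suc k) < e" using nat_approx_posE by blast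
      then show "\<forall>\<^sub>F n in sequentially. dist ((\<Sum>i<n. X i \<omega>) / real n) m < e"
        using elim[rule_format, of k] by (auto simp: dist_real_def elim!: eventually_mono)
    qed
  qed
qed

section \<open>Rescaling in weak convergence and the central limit theorem\<close>

lemma cdf_distr_scale:
  assumes "real_distribution M" "c > 0"
  shows "cdf (distr M borel (\<lambda>x. c * x)) t = cdf M (t / c)"
proof -
  interpret real_distribution M by fact
  have "(\<lambda>x. c * x) -` {..t} = {..t / c}" using assms(2) by (auto simp: field_simps)
  then show ?thesis by (simp add: cdf_def measure_distr)
qed

text \<open>Scaling by c > 0 replaces cdf(t) by cdf(t / c), and continuity of the rescaled limit at
  t is carried back to t / c by substituting s * c.\<close>

lemma weak_conv_m_scale:
  assumes "weak_conv_m M N" "\<And>n. real_distribution (M n)" "real_distribution N" "c > 0"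
  shows "weak_conv_m (\<lambda>n. distr (M n) borel (\<lambda>x. c * x)) (distr N borel (\<lambda>x. c * x))"
proof -
  have "(\<lambda>n. cdf (M n) (t / c)) \<longlonglongrightarrow> cdf N (t / c)" if "isCont (\<lambda>t. cdf N (t / c)) t" for t
  proof -
    have "isCont (\<lambda>s. cdf N (s * c / c)) (t / c)"
      by (rule isCont_o2[where f = "\<lambda>s. s * c"]) (use that assms(4) in auto)
    then have "isCont (cdf N) (t / c)" using assms(4) by simp
    then show ?thesis using assms(1) by (simp add: weak_conv_m_def weak_conv_def)
  qed
  moreover have "cdf (distr K borel (\<lambda>x. c * x)) = (\<lambda>t. cdf K (t / c))" if "real_distribution K" for K
    using cdf_distr_scale[OF that assms(4)] by (rule ext)
  ultimately show ?thesis
    unfolding weak_conv_m_def weak_conv_def by (simp only: assms(2,3)) simp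
qed

lemma distr_std_normal_scale:
  assumes "\<sigma> > 0"
  shows "distr std_normal_distribution borel (\<lambda>x. \<sigma> * x) = density lborel (normal_density 0 \<sigma>)"
proof -
  interpret prob_space std_normal_distribution by (rule prob_space_normal_density) simp
  have "distributed std_normal_distribution lborel (\<lambda>x. 0 + \<sigma> * x) (normal_density (0 + \<sigma> * 0) (\<bar>\<sigma>\<bar> * 1))"
    by (rule normal_density_affine) (use assms in \<open>auto simp: distributed_def distr_id2\<close>)
  then show ?thesis using assms by (simp add: distributed_def cong: distr_cong)
qed

lemma (in prob_space) central_limit_theorem_mean:
  fixes X :: "nat \<Rightarrow> 'a \<Rightarrow> real"
  assumes indep: "indep_vars (\<lambda>_. borel) X UNIV"
    and mean: "\<And>n. expectation (X n) = m" and \<sigma>: "\<sigma> > 0"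
    and sq: "\<And>n. integrable M (\<lambda>x. (X n x)\<^sup>2)" and var: "\<And>n. variance (X n) = \<sigma>\<^sup>2"
    and distr: "\<And>n. distr M borel (X n) = \<mu>"
  shows "weak_conv_m (\<lambda>n. distr M borel (\<lambda>x. sqrt (real n) * ((\<Sum>i<n. X i x) / real n - m)))
           (density lborel (normal_density 0 \<sigma>))"
proof -
  have rv [measurable]: "random_variable borel (X i)" for i
    using indep unfolding indep_vars_def2 by simp
  have "weak_conv_m (\<lambda>n. distr M borel (\<lambda>x. (\<Sum>i<n. X i x - m) / sqrt (real n * \<sigma>\<^sup>2))) std_normal_distribution"
    by (rule central_limit_theorem[OF indep mean \<sigma> sq var distr])
  then have "weak_conv_m (\<lambda>n. distr (distr M borel (\<lambda>x. (\<Sum>i<n. X i x - m) / sqrt (real n * \<sigma>\<^sup>2))) borel (\<lambda>x. \<sigma> * x)) 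
     (distr std_normal_distribution borel (\<lambda>x. \<sigma> * x))"
    by (rule weak_conv_m_scale) (use \<sigma> in \<open>auto intro!: real_distribution_distr real_dist_normal_dist\<close>)
  also have "distr std_normal_distribution borel (\<lambda>x. \<sigma> * x) = density lborel (normal_density 0 \<sigma>)"
    by (rule distr_std_normal_scale[OF \<sigma>])
  also have "(\<lambda>n. distr (distr M borel (\<lambda>x. (\<Sum>i<n. X i x - m) / sqrt (real n * \<sigma>\<^sup>2))) borel (\<lambda>x. \<sigma> * x))
     = (\<lambda>n. distr M borel (\<lambda>x. sqrt (real n) * ((\<Sum>i<n. X i x) / real n - m)))"
  proof
    fix n
    have "\<sigma> * ((\<Sum>i<n. X i x - m) / sqrt (real n * \<sigma>\<^sup>2)) = sqrt (real n) * ((\<Sum>i<n. X i x) / real n - m)" for x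
    proof (cases "n = 0")
      case False
      have "sqrt (real n * \<sigma>\<^sup>2) = sqrt (real n) * \<sigma>" using \<sigma> by (simp add: real_sqrt_mult)
      then have "\<sigma> * ((\<Sum>i<n. X i x - m) / sqrt (real n * \<sigma>\<^sup>2)) = (\<Sum>i<n. X i x - m) / sqrt (real n)"
        using \<sigma> by simp
      also have "\<dots> = sqrt (real n) * (\<Sum>i<n. X i x - m) / (sqrt (real n) * sqrt (real n))"
        by (rule mult_divide_mult_cancel_left[symmetric]) (use False in simp)
      also have "\<dots> = sqrt (real n) * ((\<Sum>i<n. X i x) / real n - m)"
        using False by (simp add: sum_subtractf field_simps)
      finally show ?thesis .
    qed simp
    then show "distr (distr M borel (\<lambda>x. (\<Sum>i<n. X i x - m) / sqrt (real n * \<sigma>\<^sup>2))) borel (\<lambda>x. \<sigma> * x)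
     = distr M borel (\<lambda>x. sqrt (real n) * ((\<Sum>i<n. X i x) / real n - m))"
      by (subst distr_distr) (simp_all add: o_def)
  qed
  finally show ?thesis .
qed

section \<open>The cardioid-type distributions\<close>

definition gegen_poly :: "nat \<Rightarrow> nat \<Rightarrow> real poly" where
  "gegen_poly d k = (if d = 1 then normalized_gegenbauer 0 k else gegenbauer_poly ((real d - 1) / 2) k)"

lemma gegen_eq_poly:
  assumes "d \<ge> 1" "\<bar>t\<bar> \<le> 1"
  shows "gegen d k t = poly (gegen_poly d k) t"
  using assms by (simp add: gegen_def gegen_poly_def cos_arccos_eq_normalized_gegenbauer poly_gegenbauer_poly)

lemma gegen_1_pos: "d \<ge> 1 \<Longrightarrow> gegen d k 1 > 0"
  by (simp add: gegen_def gegenbauer_1 gegenbauer_one_pos)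

lemma tau_pos: "d \<ge> 1 \<Longrightarrow> tau k d > 0"
  by (simp add: tau_def add_pos_nonneg)

text \<open>The common value is the dimension of the space of spherical harmonics of degree k; it
  becomes the constant term of the variance.\<close>

lemma tau_gegen_1:
  assumes "d \<ge> 1"
  shows "tau k d * gegen d k 1 = dkd k d"
proof (cases "d = 1")
  case True
  then show ?thesis by (simp add: tau_def dkd_def gegen_def)
next
  case False
  then have "real d - 1 > 0" using assms by simp
  then have "real d - 1 \<notin> \<int>\<^sub>\<le>\<^sub>0" by (auto dest!: nonpos_Ints_nonpos)
  then have "pochhammer (real d - 1) k = Gamma (real d - 1 + real k) / Gamma (real d - 1)"
    by (rule pochhammer_Gamma)
  moreover have "2 * ((real d - 1) / 2) = real d - 1" by (simp add: field_simps)
  ultimately show ?thesis using False by (simp only: tau_def dkd_def gegen_def gegenbauer_1 gegenbauer_one_def) simp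
qed

text \<open>For k = 2j the half sum is s = 3j and s - k = j, so the Pochhammer symbols become
  quotients of Gamma at l + j, l + 3j, 2l + 2j, 2l + 3j by Gamma at l, 2l. For odd k both sides
  vanish.\<close>

lemma eta_eq_triple_mean:
  assumes d: "d \<ge> 2"
  defines "l \<equiv> (real d - 1) / 2"
  shows "(tau k d)\<^sup>2 * triple_mean l k k k = gegen d k 1 * (eta k d * (if even k then 1 else 0))"
proof (cases "even k")
  case False
  then show ?thesis by (simp add: triple_mean_def)
next
  case True
  then obtain j where k: "k = 2 * j" by (elim evenE)
  have l: "l > 0" using d by (simp add: l_def)
  have dl: "real d = 2 * l + 1" by (simp add: l_def field_simps)
  have np: "x \<notin> \<int>\<^sub>\<le>\<^sub>0" if "x > 0" for x :: real using that by (auto dest!: nonpos_Ints_nonpos)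
  \<comment> \<open>With the six Gamma values as positive atoms, a rational identity
    remains.\<close>
  define g1 g2 gj g2j g3j g6j where "g1 = Gamma l" and "g2 = Gamma (2 * l)" and "gj = Gamma (l + real j)"
    and "g2j = Gamma (2 * l + 2 * real j)" and "g3j = Gamma (l + 3 * real j)" and "g6j = Gamma (2 * l + 3 * real j)"
  note g_defs = g1_def g2_def gj_def g2j_def g3j_def g6j_def
  have pos: "g1 > 0" "g2 > 0" "gj > 0" "g2j > 0" "g3j > 0" "g6j > 0"
    unfolding g_defs using l by (auto intro!: Gamma_real_pos add_pos_nonneg)
  have p1: "pochhammer l j = gj / g1" unfolding g_defs using l by (intro pochhammer_Gamma np)
  have p2: "pochhammer (2 * l) (3 * j) = g6j / g2" 
    using pochhammer_Gamma[of "2 * l" "3 * j"] l np[of "2 * l"] by (simp add: g_defs)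
  have p3: "pochhammer l (3 * j) = g3j / g1" 
    using pochhammer_Gamma[of l "3 * j"] l np[of l] by (simp add: g_defs)
  have p4: "pochhammer (2 * l) k = g2j / g2" 
    using pochhammer_Gamma[of "2 * l" k] l np[of "2 * l"] by (simp add: g_defs k)
  have triple_mean: "triple_mean l k k k = l / (3 * real j + l) * (g6j / g2) / (g3j / g1) * (gj / g1 / fact j) ^ 3"
    by (subst triple_mean_eq[of _ _ _ "3 * j"])
       (simp_all add: k poch_ratio_def triple_factor_def p1 p2 p3 power3_eq_cube)
  have tau: "tau k d = (l + 2 * real j) / l" using d l by (simp add: tau_def dl k field_simps)
  have g: "gegen d k 1 = g2j / g2 / fact (2 * j)" 
    using d by (simp add: gegen_def gegenbauer_1 gegenbauer_one_def p4[symmetric] l_def[symmetric] k)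
  have a1: "(2 * l + 1 + real k - 1) / 2 = l + real j" "2 * l + 1 + 3 * real k / 2 - 1 = 2 * l + 3 * real j"
    "2 * l + 1 + real k - 1 = 2 * l + 2 * real j" "(2 * l + 1 + 3 * real k - 1) / 2 = l + 3 * real j"
    "(2 * l + 1 - 1) / 2 = l" "k div 2 = j"
    "(2 * l + 2 * real j) / 2 = l + real j" by (simp_all add: k)
  have "eta k d = (2 * real k + 2 * l + 1 - 1)\<^sup>2 / ((3 * real k + 2 * l + 1 - 1) * (2 * l)) * (fact k / fact j ^ 3) *
     (gj ^ 3 * g6j) / (g2j * g1\<^sup>2 * g3j)"
    using d unfolding eta_def dl a1 g_defs by simp
  also have "\<dots> = 2 * (2 * real j + l)\<^sup>2 / ((3 * real j + l) * l) / 2 * (fact (2 * j) / fact j ^ 3) *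
     (gj ^ 3 * g6j) / (g2j * g1\<^sup>2 * g3j)"
  proof -
    have "(2 * real k + 2 * l + 1 - 1)\<^sup>2 / ((3 * real k + 2 * l + 1 - 1) * (2 * l))
      = (4 * (2 * real j + l)\<^sup>2) / (4 * ((3 * real j + l) * l))"
      by (simp add: k power2_eq_square algebra_simps)
    also have "\<dots> = 2 * (2 * real j + l)\<^sup>2 / ((3 * real j + l) * l) / 2" by simp
    finally show ?thesis by (simp only: k)
  qed
  finally have eta: "eta k d = (2 * real j + l)\<^sup>2 / ((3 * real j + l) * l) * (fact (2 * j) / fact j ^ 3) *
     (gj ^ 3 * g6j) / (g2j * g1\<^sup>2 * g3j)" by simp
  have "3 * real j + l \<noteq> 0" "l + 2 * real j \<noteq> 0" using l by (auto simp: add_nonneg_eq_0_iff)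
  then show ?thesis unfolding triple_mean tau g eta using True l pos
    by (simp add: divide_simps power2_eq_square power3_eq_cube add.commute[of l])
qed

locale cardioid_setting =
  fixes \<mu> :: "'a::euclidean_space" and d k :: nat
  assumes \<mu>: "norm \<mu> = 1" and dim: "DIM('a) \<ge> 2" and k: "k \<ge> 1" and d_def: "d = DIM('a) - 1"
begin

lemma d: "d \<ge> 1" using dim by (simp add: d_def)

sublocale gegen_functional "(real d - 1) / 2" "sphere_mean \<mu>"
  unfolding d_def by (rule gegen_functional_sphere_mean[OF \<mu> dim])

abbreviation "P \<equiv> gegen_poly d k"
abbreviation "C1 \<equiv> gegen d k 1"

text \<open>The mean sees only |t| \<le> 1; this admits trigonometric identities through
  \<open>arccos\<close> for d = 1.\<close>

lemma sphere_mean_cong: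
  fixes p q :: "real poly"
  assumes "\<And>t. \<bar>t\<bar> \<le> 1 \<Longrightarrow> poly p t = poly q t"
  shows "sphere_mean \<mu> p = sphere_mean \<mu> q"
proof -
  have "(\<integral>x. poly p (x \<bullet> \<mu>) \<partial>sphere_measure) = (\<integral>x. poly q (x \<bullet> \<mu>) \<partial>sphere_measure)"
  proof (rule integral_cong_AE)
    show "AE x in sphere_measure. poly p (x \<bullet> \<mu>) = poly q (x \<bullet> \<mu>)"
      using AE_sphere_measure
    proof eventually_elim
      case (elim x)
      then have "\<bar>x \<bullet> \<mu>\<bar> \<le> 1" using Cauchy_Schwarz_ineq2[of x \<mu>] \<mu> by simp
      then show ?case using assms by simp
    qed
  qed (use integrable_sphere_poly[OF \<mu>] in auto)
  then show ?thesis by (simp add: sphere_mean_def)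
qed

lemma sphere_mean_gegen: "sphere_mean \<mu> P = 0"
proof (cases "d = 1")
  case True
  then show ?thesis using L_normalized_gegenbauer[of k] k by (simp add: gegen_poly_def)
next
  case False
  then show ?thesis using L_gegenbauer_poly[of k] k by (simp add: gegen_poly_def)
qed

lemma L_cheb:
  assumes "d = 1" "n \<ge> 1"
  shows "sphere_mean \<mu> (normalized_gegenbauer 0 n) = 0"
  using L_normalized_gegenbauer[of n] assms by simp

text \<open>For d \<ge> 2 the third factor in \<open>L_triple\<close> is C_0 = 1. For d = 1, cos^2 y
  = (1 + cos 2y)/2 and the second harmonic has mean zero.\<close>

lemma sphere_mean_gegen_square: "sphere_mean \<mu> (P * P) = C1 / tau k d"
proof (cases "d = 1")
  case True
  have "sphere_mean \<mu> (P * P) = sphere_mean \<mu> (smult (1/2) (normalized_gegenbauer 0 (2 * k) + 1))"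
  proof (rule sphere_mean_cong)
    fix t :: real assume t: "\<bar>t\<bar> \<le> 1"
    have "cos (real (2 * k) * arccos t) = 2 * (cos (real k * arccos t))\<^sup>2 - 1"
      using cos_double_cos[of "real k * arccos t"] by (simp add: mult.assoc)
    then show "poly (P * P) t = poly (smult (1/2) (normalized_gegenbauer 0 (2 * k) + 1)) t"
      using True unfolding cos_arccos_eq_normalized_gegenbauer[OF t] by (simp add: gegen_poly_def power2_eq_square)
  qed
  also have "\<dots> = 1 / 2" using L_cheb[OF True, of "2 * k"] k by (simp add: L_smult L_add L_1)
  finally show ?thesis using True k by (simp add: tau_def gegen_def)
next
  case False
  define l where "l = (real d - 1) / 2"
  have l: "l > 0" using False d by (simp add: l_def)
  have "sphere_mean \<mu> (P * P) = triple_mean l k k 0"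
    using L_triple[of k k 0] l False by (simp add: gegen_poly_def l_def gegenbauer_poly_0)
  also have "\<dots> = l / (real k + l) * gegenbauer_one l k"
    using l pochhammer_pos[OF l, of k]
    by (subst triple_mean_eq[of _ _ _ k]) (simp_all add: poch_ratio_def triple_factor_def gegenbauer_one_def)
  also have "gegenbauer_one l k = C1" using False by (simp add: gegen_def gegenbauer_1 l_def)
  also have "l / (real k + l) * C1 = C1 / tau k d"
    using False l d by (simp add: tau_def l_def field_simps)
  finally show ?thesis .
qed

text \<open>For d = 1, 4 cos^3 y = cos 3y + 3 cos y has mean zero, which is the reason for
  \<open>eta k 1 = 0\<close>.\<close>

lemma sphere_mean_gegen_cube: "sphere_mean \<mu> (P * P * P) = C1 * (eta k d * (if even k then 1 else 0)) / (tau k d)\<^sup>2"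
proof (cases "d = 1")
  case True
  have "sphere_mean \<mu> (P * P * P) = sphere_mean \<mu> (smult (1/4) (normalized_gegenbauer 0 (3 * k)) + smult (3/4) (normalized_gegenbauer 0 k))"
  proof (rule sphere_mean_cong)
    fix t :: real assume t: "\<bar>t\<bar> \<le> 1"
    have "cos (real (3 * k) * arccos t) = 4 * (cos (real k * arccos t)) ^ 3 - 3 * cos (real k * arccos t)"
      using cos_treble_cos[of "real k * arccos t"] by (simp add: mult.assoc)
    then show "poly (P * P * P) t = poly (smult (1/4) (normalized_gegenbauer 0 (3 * k)) + smult (3/4) (normalized_gegenbauer 0 k)) t"
      using True unfolding cos_arccos_eq_normalized_gegenbauer[OF t] by (simp add: gegen_poly_def power3_eq_cube field_simps)
  qed
  also have "\<dots> = 0" using L_cheb[OF True] k by (simp add: L_smult L_add)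
  finally show ?thesis using True by (simp add: eta_def)
next
  case False
  define l where "l = (real d - 1) / 2"
  have l: "l > 0" using False d by (simp add: l_def)
  have "sphere_mean \<mu> (P * P * P) = triple_mean l k k k"
    using L_triple[of k k k] l False by (simp add: gegen_poly_def l_def)
  then show ?thesis using eta_eq_triple_mean[of d k] False d tau_pos[OF d, of k]
    by (simp add: l_def field_simps)
qed

text \<open>Rules out a vanishing variance: the product polynomial would then be zero almost everywhere, and
  testing it against the Gegenbauer polynomial of degree \<open>2 k\<close> isolates its quadratic term.\<close>

lemma rho_eq_0_if_degenerate:
  assumes d2: "d \<noteq> 1"
    and z: "\<And>q. sphere_mean \<mu> (q * ((smult (tau k d) P - [:\<rho>:]) * (1 + smult (\<rho> / C1) P))) = 0"
  shows "\<rho> = 0"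
proof -
  define l where "l = (real d - 1) / 2"
  have l: "l > 0" using d2 d by (simp add: l_def)
  let ?q = "gegenbauer_poly l (2 * k)"
  have P: "P = gegenbauer_poly l k" using d2 by (simp add: gegen_poly_def l_def)
  note L_triple' = L_triple[folded l_def, OF l]
  have 1: "sphere_mean \<mu> ?q = 0" using L_gegenbauer_poly[of "2 * k"] k by (simp add: l_def)
  have 2: "sphere_mean \<mu> (?q * P) = 0"
  proof -
    have "sphere_mean \<mu> (?q * P) = triple_mean l (2 * k) k 0"
      using L_triple'[of "2 * k" k 0] by (simp add: P gegenbauer_poly_0[folded l_def])
    \<comment> \<open>Degree 2k exceeds k + 0: either the degree sum is odd or the index s - 2k is
      negative.\<close>
    also have "\<dots> = 0" using k by (auto simp: triple_mean_def poch_ratio_def Let_def)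
    finally show ?thesis .
  qed
  have 3: "sphere_mean \<mu> (?q * (P * P)) > 0"
  proof -
    have "sphere_mean \<mu> (?q * (P * P)) = triple_mean l (2 * k) k k"
      using L_triple'[of "2 * k" k k] by (simp add: P mult.assoc)
    also have "\<dots> > 0" using k l
      by (subst triple_mean_eq[of _ _ _ "2 * k"]) (simp_all add: poch_ratio_def triple_factor_def pochhammer_pos)
    finally show ?thesis .
  qed
  have "?q * ((smult (tau k d) P - [:\<rho>:]) * (1 + smult (\<rho> / C1) P))
     = smult (tau k d * \<rho> / C1) (?q * (P * P)) + smult (tau k d - \<rho> * \<rho> / C1) (?q * P) - smult \<rho> ?q"
    by (simp add: algebra_simps smult_diff_right smult_add_right smult_diff_left)
  then have "tau k d * \<rho> / C1 * sphere_mean \<mu> (?q * (P * P)) = 0"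
    using z[of ?q] by (simp add: L_diff L_add L_smult 1 2)
  then show ?thesis using 3 tau_pos[OF d, of k] gegen_1_pos[OF d, of k] by simp
qed

end

text \<open>Outside [-1,1] the definite description in \<open>arccos\<close> is applied to an
  unsatisfiable predicate, the same for every such x, so \<open>arccos\<close> is constant there; on
  [-1,1] it is continuous.\<close>

lemma measurable_arccos [measurable]: "arccos \<in> borel_measurable borel"
proof -
  have "arccos x = arccos 2" if "x \<notin> {-1..1}" for x
  proof -
    have "(\<lambda>y. 0 \<le> y \<and> y \<le> pi \<and> cos y = z) = (\<lambda>_. False)" if "z \<notin> {-1..1}" for z :: real
      using that cos_ge_minus_one cos_le_one by (auto simp: fun_eq_iff)
    from this[OF that] this[of 2] show ?thesis by (simp add: arccos_def)
  qed
  note const = this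
  have "arccos x = (if x \<in> {-1..1} then arccos x else arccos 2)" for x
    using const[of x] by (cases "x \<in> {-1..1}") simp_all
  then have "arccos = (\<lambda>x. if x \<in> {-1..1} then arccos x else arccos 2)" by (rule ext)
  also have "\<dots> \<in> borel_measurable borel"
    by (intro borel_measurable_continuous_on_if continuous_intros continuous_on_arccos') auto
  finally show ?thesis .
qed

lemma continuous_on_gegenbauer: "continuous_on A (gegenbauer l n)"
  by (induction l n "0::real" rule: gegenbauer.induct) (auto simp: fun_eq_iff intro!: continuous_intros)

lemma measurable_gegen [measurable]: "gegen d k \<in> borel_measurable borel"
proof (cases "d = 1")
  case True
  have "(\<lambda>x. cos (real k * arccos x)) \<in> borel_measurable borel" by measurable
  then show ?thesis using True by (simp add: gegen_def[abs_def])
next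
  case False
  have "gegen d k = gegenbauer ((real d - 1) / 2) k" using False by (simp add: gegen_def fun_eq_iff)
  then show ?thesis using borel_measurable_continuous_onI[OF continuous_on_gegenbauer] by simp
qed

section \<open>Mean, variance and nondegeneracy of one summand\<close>

context cardioid_setting
begin

definition Ck_density :: "real \<Rightarrow> 'a \<Rightarrow> real" where
  "Ck_density \<rho> x = (1 + \<rho> * gegen_norm d k (x \<bullet> \<mu>)) / omega d"

lemma gegen_inner_measurable [measurable]: "(\<lambda>x. gegen d k (x \<bullet> \<mu>)) \<in> borel_measurable borel"
  by (rule measurable_compose[OF _ measurable_gegen]) simp

lemma Ck_density_measurable [measurable]: "Ck_density \<rho> \<in> borel_measurable borel"
  unfolding Ck_density_def[abs_def] gegen_norm_def
  by (intro borel_measurable_divide borel_measurable_add borel_measurable_times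
      gegen_inner_measurable borel_measurable_const)

lemma Ck_dist_eq: "Ck_dist k \<mu> \<rho> = density sphere_measure (\<lambda>x. ennreal (Ck_density \<rho> x))"
  unfolding Ck_dist_def Let_def d_def[symmetric] Ck_density_def ..

abbreviation "W \<rho> \<equiv> 1 + smult (\<rho> / C1) P"

lemma AE_unit: "AE x in sphere_measure. \<bar>x \<bullet> \<mu>\<bar> \<le> 1"
  using AE_sphere_measure
proof eventually_elim
  case (elim x)
  then show ?case using Cauchy_Schwarz_ineq2[of x \<mu>] \<mu> by simp
qed

lemma Ck_density_eq: "AE x in sphere_measure. Ck_density \<rho> x = poly (W \<rho>) (x \<bullet> \<mu>) / omega d"
  using AE_unit by eventually_elim (simp add: Ck_density_def gegen_norm_def gegen_eq_poly[OF d])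

lemma integral_Ck_density: "(\<integral>x. poly q (x \<bullet> \<mu>) * Ck_density \<rho> x \<partial>sphere_measure) = sphere_mean \<mu> (q * W \<rho>)"
  and integrable_Ck_density: "integrable sphere_measure (\<lambda>x. poly q (x \<bullet> \<mu>) * Ck_density \<rho> x)"
proof -
  have [measurable]: "(\<lambda>x. poly q (x \<bullet> \<mu>)) \<in> borel_measurable sphere_measure" for q
    using integrable_sphere_poly[OF \<mu>] by (rule borel_measurable_integrable)
  have ae: "AE x in sphere_measure. poly q (x \<bullet> \<mu>) * Ck_density \<rho> x = poly (q * W \<rho>) (x \<bullet> \<mu>) / omega d"
    using Ck_density_eq[of \<rho>] by eventually_elim simp
  have "(\<integral>x. poly q (x \<bullet> \<mu>) * Ck_density \<rho> x \<partial>sphere_measure) = (\<integral>x. poly (q * W \<rho>) (x \<bullet> \<mu>) / omega d \<partial>sphere_measure)"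
    by (rule integral_cong_AE[OF _ _ ae]) measurable
  then show "(\<integral>x. poly q (x \<bullet> \<mu>) * Ck_density \<rho> x \<partial>sphere_measure) = sphere_mean \<mu> (q * W \<rho>)"
    by (simp add: sphere_mean_def d_def del: poly_mult poly_add)
  have "integrable sphere_measure (\<lambda>x. poly (q * W \<rho>) (x \<bullet> \<mu>) / omega d)"
    using integrable_sphere_poly[OF \<mu>] by (intro integrable_divide)
  then show "integrable sphere_measure (\<lambda>x. poly q (x \<bullet> \<mu>) * Ck_density \<rho> x)"
    by (subst integrable_cong_AE[OF _ _ ae]) auto
qed

text \<open>Orthogonality gives total mass one to the density without its truncation at zero, so if the
  truncated density is a probability density, then no truncation takes place.\<close>

lemma Ck_density_nonneg:
  assumes "prob_space (Ck_dist k \<mu> \<rho>)"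
  shows "AE x in sphere_measure. Ck_density \<rho> x \<ge> 0"
proof -
  interpret C: prob_space "Ck_dist k \<mu> \<rho>" by fact
  have int: "integrable sphere_measure (Ck_density \<rho>)" using integrable_Ck_density[of 1 \<rho>] by simp
  have "emeasure (Ck_dist k \<mu> \<rho>) UNIV = 1"
    using C.emeasure_space_1 by (simp add: Ck_dist_eq)
  then have 1: "(\<integral>\<^sup>+x. ennreal (Ck_density \<rho> x) \<partial>sphere_measure) = 1"
    by (simp add: Ck_dist_eq emeasure_density)
  have "(\<integral>x. Ck_density \<rho> x \<partial>sphere_measure) = 1"
    using integral_Ck_density[of 1 \<rho>] by (simp add: L_add L_smult L_1 sphere_mean_gegen)
  then have "enn2real (\<integral>\<^sup>+x. ennreal (- Ck_density \<rho> x) \<partial>sphere_measure) = 0"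
    using real_lebesgue_integral_def[OF int] by (simp add: 1)
  moreover have "(\<integral>\<^sup>+x. ennreal (- Ck_density \<rho> x) \<partial>sphere_measure) \<noteq> \<infinity>"
    using int by (simp add: real_integrable_def)
  ultimately have "(\<integral>\<^sup>+x. ennreal (- Ck_density \<rho> x) \<partial>sphere_measure) = 0"
    by (simp add: enn2real_eq_0_iff)
  then have "AE x in sphere_measure. ennreal (- Ck_density \<rho> x) = 0"
    by (subst (asm) nn_integral_0_iff_AE) auto
  then show ?thesis by eventually_elim (auto simp: ennreal_eq_0_iff)
qed

lemma Ck_mean:
  assumes "prob_space (Ck_dist k \<mu> \<rho>)"
  shows "integrable (Ck_dist k \<mu> \<rho>) (\<lambda>x. poly q (x \<bullet> \<mu>))"
    and "(\<integral>x. poly q (x \<bullet> \<mu>) \<partial>Ck_dist k \<mu> \<rho>) = sphere_mean \<mu> (q * W \<rho>)"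
proof -
  have [measurable]: "(\<lambda>x. poly q (x \<bullet> \<mu>)) \<in> borel_measurable sphere_measure"
    using integrable_sphere_poly[OF \<mu>] by (rule borel_measurable_integrable)
  show "integrable (Ck_dist k \<mu> \<rho>) (\<lambda>x. poly q (x \<bullet> \<mu>))"
    unfolding Ck_dist_eq using integrable_Ck_density[of q \<rho>] Ck_density_nonneg[OF assms]
    by (subst integrable_real_density) (simp_all add: mult.commute)
  show "(\<integral>x. poly q (x \<bullet> \<mu>) \<partial>Ck_dist k \<mu> \<rho>) = sphere_mean \<mu> (q * W \<rho>)"
    unfolding Ck_dist_eq using integral_Ck_density[of q \<rho>] Ck_density_nonneg[OF assms]
    by (subst integral_real_density) (simp_all add: mult.commute)
qed

lemma AE_Ck_unit: "AE x in Ck_dist k \<mu> \<rho>. \<bar>x \<bullet> \<mu>\<bar> \<le> 1"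
  unfolding Ck_dist_eq using AE_unit by (subst AE_density) auto

definition rho_GM_term :: "'a \<Rightarrow> real" where
  "rho_GM_term x = tau k d * gegen d k (x \<bullet> \<mu>)"

lemma measurable_rho_GM_term [measurable]: "rho_GM_term \<in> borel_measurable borel"
  unfolding rho_GM_term_def[abs_def] by (intro borel_measurable_times gegen_inner_measurable borel_measurable_const)

lemma rho_GM_term_eq: "AE x in Ck_dist k \<mu> \<rho>. rho_GM_term x = poly (smult (tau k d) P) (x \<bullet> \<mu>)"
  using AE_Ck_unit by eventually_elim (simp add: rho_GM_term_def gegen_eq_poly[OF d])

lemma sets_Ck [simp, measurable_cong]: "sets (Ck_dist k \<mu> \<rho>) = sets borel"
  by (simp add: Ck_dist_eq)

text \<open>The density is (1 + (rho/C1) P(t)) / omega. Since P has mean zero, the mean is tau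
  (rho/C1) (C1/tau) = rho; in the second moment the square contributes tau C1 = d_(k,d) and the cube
  contributes the term with \<open>eta\<close>.\<close>

lemma rho_GM_term_moments:
  assumes "prob_space (Ck_dist k \<mu> \<rho>)"
  shows "integrable (Ck_dist k \<mu> \<rho>) rho_GM_term" "(\<integral>x. rho_GM_term x \<partial>Ck_dist k \<mu> \<rho>) = \<rho>"
    and "integrable (Ck_dist k \<mu> \<rho>) (\<lambda>x. (rho_GM_term x)\<^sup>2)" 
    and "(\<integral>x. (rho_GM_term x)\<^sup>2 \<partial>Ck_dist k \<mu> \<rho>) = sigma2_GM k d \<rho> + \<rho>\<^sup>2"
proof -
  let ?q = "smult (tau k d) P"
  have pos: "tau k d > 0" "C1 > 0" using tau_pos[OF d] gegen_1_pos[OF d] by auto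
  note mean = Ck_mean[OF assms, of ?q] Ck_mean[OF assms, of "?q * ?q"]
  have [measurable]: "(\<lambda>x. poly q (x \<bullet> \<mu>)) \<in> borel_measurable borel" for q
    using borel_measurable_integrable[OF integrable_sphere_poly[OF \<mu>, of q]] by simp
  have ae2: "AE x in Ck_dist k \<mu> \<rho>. (rho_GM_term x)\<^sup>2 = poly (?q * ?q) (x \<bullet> \<mu>)"
    using rho_GM_term_eq by eventually_elim (simp add: power2_eq_square)
  show "integrable (Ck_dist k \<mu> \<rho>) rho_GM_term"
    by (subst integrable_cong_AE[OF _ _ rho_GM_term_eq]) (use mean in auto)
  show "integrable (Ck_dist k \<mu> \<rho>) (\<lambda>x. (rho_GM_term x)\<^sup>2)"
    by (subst integrable_cong_AE[OF _ _ ae2]) (use mean in auto)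
  have "(\<integral>x. rho_GM_term x \<partial>Ck_dist k \<mu> \<rho>) = sphere_mean \<mu> (?q * W \<rho>)"
    unfolding mean(2)[symmetric] by (rule integral_cong_AE[OF _ _ rho_GM_term_eq]) auto
  also have "?q * W \<rho> = smult (tau k d) P + smult (tau k d * \<rho> / C1) (P * P)"
    by (simp add: algebra_simps)
  also have "sphere_mean \<mu> \<dots> = \<rho>"
    using pos by (simp add: L_add L_smult sphere_mean_gegen sphere_mean_gegen_square)
  finally show "(\<integral>x. rho_GM_term x \<partial>Ck_dist k \<mu> \<rho>) = \<rho>" .
  have "(\<integral>x. (rho_GM_term x)\<^sup>2 \<partial>Ck_dist k \<mu> \<rho>) = sphere_mean \<mu> (?q * ?q * W \<rho>)"
    unfolding mean(4)[symmetric] by (rule integral_cong_AE[OF _ _ ae2]) auto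
  also have "?q * ?q * W \<rho> = smult ((tau k d)\<^sup>2) (P * P) + smult ((tau k d)\<^sup>2 * \<rho> / C1) (P * P * P)"
    by (simp add: algebra_simps smult_add_right power2_eq_square)
  also have "sphere_mean \<mu> \<dots> = tau k d * C1 + \<rho> * (eta k d * (if even k then 1 else 0))"
    unfolding L_add L_smult sphere_mean_gegen_square sphere_mean_gegen_cube using pos by (simp add: power2_eq_square)
  finally show "(\<integral>x. (rho_GM_term x)\<^sup>2 \<partial>Ck_dist k \<mu> \<rho>) = sigma2_GM k d \<rho> + \<rho>\<^sup>2"
    using tau_gegen_1[OF d, of k] by (simp add: sigma2_GM_def)
qed

lemma rho_GM_term_variance:
  assumes "prob_space (Ck_dist k \<mu> \<rho>)"
  shows "(\<integral>x. (rho_GM_term x - \<rho>)\<^sup>2 \<partial>Ck_dist k \<mu> \<rho>) = sigma2_GM k d \<rho>"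
proof -
  interpret C: prob_space "Ck_dist k \<mu> \<rho>" by fact
  show ?thesis using C.variance_eq[OF rho_GM_term_moments(1,3)[OF assms]] by (simp add: rho_GM_term_moments[OF assms])
qed

text \<open>For d = 1 the variance is 2 - rho^2 \<ge> 1. For d \<ge> 2 a zero variance would make
  the summand equal to rho wherever the density is positive, which forces rho = 0 by
  \<open>rho_eq_0_if_degenerate\<close>; but then the variance is d_(k,d) > 0.\<close>

lemma sigma2_pos:
  assumes C: "prob_space (Ck_dist k \<mu> \<rho>)" and \<rho>: "\<bar>\<rho>\<bar> \<le> 1"
  shows "sigma2_GM k d \<rho> > 0"
proof (cases "d = 1")
  case True
  have "\<rho>\<^sup>2 \<le> 1" using \<rho> by (simp add: abs_square_le_1)
  then show ?thesis using True k by (simp add: sigma2_GM_def dkd_def eta_def)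
next
  case False
  interpret C: prob_space "Ck_dist k \<mu> \<rho>" by fact
  have "sigma2_GM k d \<rho> \<ge> 0"
    unfolding rho_GM_term_variance[OF C, symmetric] by simp
  moreover have "sigma2_GM k d \<rho> \<noteq> 0"
  proof
    assume 0: "sigma2_GM k d \<rho> = 0"
    have "integrable (Ck_dist k \<mu> \<rho>) (\<lambda>x. (rho_GM_term x - \<rho>)\<^sup>2)"
      using rho_GM_term_moments[OF C] by (simp add: power2_diff)
    then have "AE x in Ck_dist k \<mu> \<rho>. (rho_GM_term x - \<rho>)\<^sup>2 = 0"
      using 0 rho_GM_term_variance[OF C] integral_nonneg_eq_0_iff_AE[of "Ck_dist k \<mu> \<rho>" "\<lambda>x. (rho_GM_term x - \<rho>)\<^sup>2"] by simp
    then have "AE x in Ck_dist k \<mu> \<rho>. rho_GM_term x = \<rho>" by simp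
    then have ae: "AE x in sphere_measure. 0 < Ck_density \<rho> x \<longrightarrow> rho_GM_term x = \<rho>"
      unfolding Ck_dist_eq by (subst (asm) AE_density) auto
    have "sphere_mean \<mu> (q * ((smult (tau k d) P - [:\<rho>:]) * W \<rho>)) = 0" for q
    proof -
      have "(\<integral>x. poly (q * (smult (tau k d) P - [:\<rho>:])) (x \<bullet> \<mu>) * Ck_density \<rho> x \<partial>sphere_measure) = 0"
      proof (rule integral_eq_zero_AE)
        \<comment> \<open>Where the density vanishes the product is zero anyway, so almost every
          point of the sphere is covered.\<close>
        show "AE x in sphere_measure. poly (q * (smult (tau k d) P - [:\<rho>:])) (x \<bullet> \<mu>) * Ck_density \<rho> x = 0"
          using ae Ck_density_nonneg[OF C] AE_unit
        proof eventually_elim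
          case (elim x)
          then show ?case
            by (cases "Ck_density \<rho> x = 0") (auto simp: rho_GM_term_def gegen_eq_poly[OF d])
        qed
      qed
      then show ?thesis unfolding integral_Ck_density by (simp add: mult.assoc)
    qed
    then have "\<rho> = 0" by (rule rho_eq_0_if_degenerate[OF False])
    then show False
      using 0 tau_gegen_1[OF d, of k] tau_pos[OF d, of k] gegen_1_pos[OF d, of k]
      by (simp add: sigma2_GM_def)
  qed
  ultimately show ?thesis by simp
qed

lemma rho_GM_term_bounded: "\<exists>B. AE x in Ck_dist k \<mu> \<rho>. \<bar>rho_GM_term x\<bar> \<le> B"
proof -
  let ?p = "poly (smult (tau k d) P)"
  have "continuous_on {-1..1} ?p" by (intro continuous_intros)
  then have "bounded (?p ` {-1..1})" by (intro compact_imp_bounded compact_continuous_image) auto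
  then obtain B where B: "\<forall>t\<in>{-1..1}. \<bar>?p t\<bar> \<le> B"
    by (auto simp: bounded_iff)
  have "AE x in Ck_dist k \<mu> \<rho>. \<bar>rho_GM_term x\<bar> \<le> B"
    using rho_GM_term_eq AE_Ck_unit by eventually_elim (use B in \<open>auto simp: abs_le_iff\<close>)
  then show ?thesis ..
qed

lemma rho_GM_eq: "rho_GM k \<mu> X n = (\<lambda>\<omega>. (\<Sum>i<n. rho_GM_term (X i \<omega>)) / real n)"
  unfolding rho_GM_def Let_def d_def[symmetric] rho_GM_term_def
  by (simp add: inner_commute sum_distrib_left[symmetric] fun_eq_iff)

end

section \<open>Closed forms of the variance in degrees one and two\<close>

lemma sigma2_GM_1:
  assumes "d \<ge> 1"
  shows "sigma2_GM 1 d \<rho> = real d + 1 - \<rho>\<^sup>2"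
proof (cases "d = 1")
  case False
  then have d: "real d - 1 > 0" using assms by simp
  then have "Gamma (real d - 1 + 1) = (real d - 1) * Gamma (real d - 1)"
    by (intro Gamma_plus1) (auto dest!: nonpos_Ints_nonpos)
  moreover have "Gamma (real d - 1) > 0" using d by (rule Gamma_real_pos)
  ultimately have "dkd 1 d = (1 + 2 / (real d - 1)) * (real d - 1)"
    using False by (simp add: dkd_def)
  also have "\<dots> = real d + 1" using d by (simp add: field_simps)
  finally show ?thesis by (simp add: sigma2_GM_def)
qed (simp add: sigma2_GM_def dkd_def)

text \<open>With l = (d-1)/2, the functional equation moves all Gamma arguments to a few base
  points, where the values cancel. For d = 1 the coefficient of rho is zero through the factor d -
  1.\<close>

lemma sigma2_GM_2:
  assumes "d \<ge> 1"
  shows "sigma2_GM 2 d \<rho> = real d * (real d + 3) / 2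
           + 2 * (real d - 1) * (real d + 3) / (real d + 5) * \<rho> - \<rho>\<^sup>2"
proof (cases "d = 1")
  case False
  define l where "l = (real d - 1) / 2"
  have l: "l > 0" using False assms by (simp add: l_def)
  have dl: "real d = 2 * l + 1" by (simp add: l_def field_simps)
  have G: "Gamma (x + 1) = x * Gamma x" if "x > 0" for x :: real
    using that by (intro Gamma_plus1) (auto dest!: nonpos_Ints_nonpos)
  have G1: "Gamma (2 * l + 1) = 2 * l * Gamma (2 * l)" using G[of "2 * l"] l by simp
  have G2: "Gamma (2 * l + 2) = (2 * l + 1) * (2 * l * Gamma (2 * l))" 
    using G[of "2 * l + 1"] G1 l by (simp add: add.assoc)
  have G3: "Gamma (2 * l + 3) = (2 * l + 2) * Gamma (2 * l + 2)" 
    using G[of "2 * l + 2"] l by (simp add: add.assoc)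
  have g1: "Gamma (l + 1) = l * Gamma l" using G[of l] l by simp
  have g2: "Gamma (l + 2) = (l + 1) * (l * Gamma l)" using G[of "l + 1"] g1 l by (simp add: add.assoc)
  have g3: "Gamma (l + 3) = (l + 2) * ((l + 1) * (l * Gamma l))" using G[of "l + 2"] g2 l by (simp add: add.assoc)
  have pos: "Gamma (2 * l) > 0" "Gamma l > 0" by (rule Gamma_real_pos, use l in simp)+
  have a: "2 * l + 1 - 1 + real 2 = 2 * l + 2" "2 * l + 1 - 1 = 2 * l" "(2 * l + 1 + real 2 - 1) / 2 = l + 1"
    "2 * l + 1 + 3 * real 2 / 2 - 1 = 2 * l + 3" "2 * l + 1 + real 2 - 1 = 2 * l + 2" "2 * l / 2 = l"
    "(2 * l + 1 + 3 * real 2 - 1) / 2 = l + 3" "2 * real 2 + (2 * l + 1) - 1 = 2 * (l + 2)" 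
    "3 * real 2 + (2 * l + 1) - 1 = 2 * (l + 3)" "(2 * l + 2) / 2 = l + 1" by simp_all
  have "dkd 2 d = (1 + 2 * real 2 / (2 * l)) * Gamma (2 * l + 2) / (Gamma (2 * l) * fact 2)"
    using False unfolding dkd_def dl a by simp
  also have "\<dots> = (l + 2) * (2 * l + 1)"
  proof -
    define g where "g = Gamma (2 * l)"
    have "g \<noteq> 0" using pos by (simp only: g_def)
    then show ?thesis unfolding G2 g_def[symmetric] using l by (simp add: divide_simps)
  qed
  finally have 1: "dkd 2 d = (l + 2) * (2 * l + 1)" .
  have 2: "eta 2 d = 4 * l * (l + 2) / (l + 3)"
  proof -
    have "eta 2 d = (2 * (l + 2))\<^sup>2 / (2 * (l + 3) * (2 * l)) * (fact 2 / fact (2 div 2) ^ 3) *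
       (Gamma (l + 1) ^ 3 * Gamma (2 * l + 3)) / (Gamma (2 * l + 2) * Gamma l ^ 2 * Gamma (l + 3))"
      using False unfolding eta_def dl a by simp
    also have "\<dots> = 4 * l * (l + 2) / (l + 3)"
    proof -
      define g h where "g = Gamma (2 * l + 2)" and "h = Gamma l"
      have "g > 0" "h > 0" unfolding g_def h_def by (rule Gamma_real_pos, use l in simp)+
      then have "g \<noteq> 0" "h \<noteq> 0" by simp_all
      then show ?thesis
        unfolding g1 g3 G3 g_def[symmetric] h_def[symmetric] using l
        by (simp add: divide_simps power2_eq_square power3_eq_cube) (simp add: algebra_simps)
    qed
    finally show ?thesis .
  qed
  have "l + 3 \<noteq> 0" using l by simp
  then show ?thesis unfolding sigma2_GM_def 1 2 dl
    by (simp add: divide_simps) (simp add: algebra_simps)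
qed (simp add: sigma2_GM_def dkd_def eta_def)

theorem theorem4:
  fixes M :: "'b measure" and X :: "nat \<Rightarrow> 'b \<Rightarrow> 'a::euclidean_space"
    and \<mu> :: 'a and \<rho> :: real and k :: nat
  defines "d \<equiv> DIM('a) - 1"
  assumes "prob_space M"
    and "DIM('a) \<ge> 2"
    and "k \<ge> 1"
    and "\<mu> \<in> sphere 0 1"
    and "\<rho> \<in> {-1..1}"
    and "prob_space.indep_vars M (\<lambda>_. borel) X UNIV"
    and "\<And>i. distr M borel (X i) = Ck_dist k \<mu> \<rho>"
  shows "(\<forall>n\<ge>1. integrable M (rho_GM k \<mu> X n) \<and>
                 prob_space.expectation M (rho_GM k \<mu> X n) = \<rho>)
    \<and> (AE \<omega> in M. (\<lambda>n. rho_GM k \<mu> X n \<omega>) \<longlonglongrightarrow> \<rho>)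
    \<and> weak_conv_m (\<lambda>n. distr M borel (\<lambda>\<omega>. sqrt (real n) * (rho_GM k \<mu> X n \<omega> - \<rho>)))
                  (density lborel (normal_density 0 (sqrt (sigma2_GM k d \<rho>))))
    \<and> sigma2_GM 1 d \<rho> = real d + 1 - \<rho>^2
    \<and> sigma2_GM 2 d \<rho> = real d * (real d + 3) / 2
                          + 2 * (real d - 1) * (real d + 3) / (real d + 5) * \<rho> - \<rho>^2"
proof -
  interpret prob_space M by fact
  interpret cardioid_setting \<mu> d k
    by unfold_locales (use assms in auto)
  note indep = assms(7) and distr_X = assms(8)
  have rv [measurable]: "random_variable borel (X i)" for i
    using indep unfolding indep_vars_def2 by simp
  \<comment> \<open>As the law of \<open>X 0\<close> this measure has total mass one, which is the
    source of the nonnegativity of the density.\<close>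
  have C: "prob_space (Ck_dist k \<mu> \<rho>)"
    unfolding distr_X[of 0, symmetric] by (rule prob_space_distr) simp
  define Y where "Y i \<omega> = rho_GM_term (X i \<omega>)" for i \<omega>
  have Y [measurable]: "random_variable borel (Y i)" for i unfolding Y_def by measurable
  have indep_Y: "indep_vars (\<lambda>_. borel) Y UNIV"
    unfolding Y_def by (rule indep_vars_compose2[OF indep]) simp
  have int_Y: "integrable M (Y i)" and mean_Y: "expectation (Y i) = \<rho>"
    and sq_Y: "integrable M (\<lambda>\<omega>. (Y i \<omega>)\<^sup>2)" and var_Y: "expectation (\<lambda>\<omega>. (Y i \<omega> - \<rho>)\<^sup>2) = sigma2_GM k d \<rho>" for i
    using rho_GM_term_moments[OF C] rho_GM_term_variance[OF C]
    unfolding distr_X[of i, symmetric] Y_def by (simp_all add: integrable_distr_eq integral_distr)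
  have distr_Y: "distr M borel (Y i) = distr (Ck_dist k \<mu> \<rho>) borel rho_GM_term" for i
    unfolding distr_X[of i, symmetric] Y_def by (subst distr_distr) (simp_all add: o_def)
  have rho: "rho_GM k \<mu> X n = (\<lambda>\<omega>. (\<Sum>i<n. Y i \<omega>) / real n)" for n
    by (simp add: rho_GM_eq Y_def)
  obtain B where B: "AE x in Ck_dist k \<mu> \<rho>. \<bar>rho_GM_term x\<bar> \<le> B" using rho_GM_term_bounded by blast
  have bound: "AE \<omega> in M. \<bar>Y i \<omega>\<bar> \<le> B" for i
    using B unfolding distr_X[of i, symmetric] Y_def by (subst (asm) AE_distr_iff) auto
  have pos: "sigma2_GM k d \<rho> > 0" using C by (rule sigma2_pos) (use assms in auto)
  have "\<forall>n\<ge>1. integrable M (rho_GM k \<mu> X n) \<and> expectation (rho_GM k \<mu> X n) = \<rho>"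
    unfolding rho using int_Y mean_Y by auto
  moreover have "AE \<omega> in M. (\<lambda>n. rho_GM k \<mu> X n \<omega>) \<longlonglongrightarrow> \<rho>"
    unfolding rho by (rule strong_law_bounded[OF indep_Y bound mean_Y])
  moreover have "weak_conv_m (\<lambda>n. distr M borel (\<lambda>\<omega>. sqrt (real n) * (rho_GM k \<mu> X n \<omega> - \<rho>)))
                  (density lborel (normal_density 0 (sqrt (sigma2_GM k d \<rho>))))"
    unfolding rho
    by (rule central_limit_theorem_mean[OF indep_Y mean_Y _ sq_Y _ distr_Y])
       (use pos var_Y in \<open>simp_all add: mean_Y\<close>)
  ultimately show ?thesis using sigma2_GM_1[OF d] sigma2_GM_2[OF d] by blast
qed

end
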